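(* For an alphabet $\Sigma=\{\sigma_1,\dots,\sigma_k\}$ of size $k\ge 2$, let $R_k(z)=\sum_{\alpha\in\mathrm{RE}_{na}} z^{|\alpha|}$ and $L_k(z)=\sum_{\alpha\in\mathrm{RE}_{na}} |\alpha|_\Sigma\, z^{|\alpha|}$, where $|\alpha|_\Sigma$ is the number of letter occurrences in $\alpha$. Then for each $k$ the limit $\ell_k:=\lim_{n\to\infty}\frac{[z^n]L_k(z)}{n\,[z^n]R_k(z)}$ (the asymptotic ratio of letters in expressions of $\mathrm{RE}_{na}$) exists, and $\lim_{k\to\infty}\ell_k=\frac12$.
   Context: Regular expressions over $\Sigma$ are generated by $\beta := \varepsilon \mid \sigma\ (\sigma\in\Sigma) \mid (\beta+\beta) \mid (\beta\cdot\beta) \mid (\beta^\star)$ (the empty-set expression is not counted). The size $|\beta|$ is the number of occurrences of the symbols $\varepsilon$, letters, $+$, $\cdot$, $\star$ in $\beta$ (parentheses not counted). A $\Sigma$-star expression is an expression $(\tau^\star)$ where $\tau$ is a fully parenthesized union of the $k$ letters, each occurring exactly once, in any order and any bracketing. $\mathrm{RE}_{na}$ ("regular expressions without $\Sigma^\star$ in unions") is the set of regular expressions having no subexpression $(\beta_1+\beta_2)$ in which $\beta_1$ or $\beta_2$ is a $\Sigma$-star expression. $[z^n]F(z)$ denotes the coefficient of $z^n$. *)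

theory Defs
  imports Complex_Main
begin

text \<open>Regular expressions over the alphabet {0..<k} (letters are naturals; the
  alphabet constraint is imposed by re_over). No empty-set expression.\<close>
datatype re = Eps | Sym nat | Plus re re | Conc re re | Star re

fun re_size :: "re \<Rightarrow> nat" where
  "re_size Eps = 1"
| "re_size (Sym a) = 1"
| "re_size (Plus a b) = re_size a + re_size b + 1"
| "re_size (Conc a b) = re_size a + re_size b + 1"
| "re_size (Star a) = re_size a + 1"

fun letters :: "re \<Rightarrow> nat" where
  "letters Eps = 0"
| "letters (Sym a) = 1"
| "letters (Plus a b) = letters a + letters b"
| "letters (Conc a b) = letters a + letters b"
| "letters (Star a) = letters a"

fun letter_list :: "re \<Rightarrow> nat list" where
  "letter_list Eps = []"
| "letter_list (Sym a) = [a]"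
| "letter_list (Plus a b) = letter_list a @ letter_list b"
| "letter_list (Conc a b) = letter_list a @ letter_list b"
| "letter_list (Star a) = letter_list a"

fun re_over :: "nat \<Rightarrow> re \<Rightarrow> bool" where
  "re_over k Eps = True"
| "re_over k (Sym a) = (a < k)"
| "re_over k (Plus a b) = (re_over k a \<and> re_over k b)"
| "re_over k (Conc a b) = (re_over k a \<and> re_over k b)"
| "re_over k (Star a) = re_over k a"

fun letter_union :: "re \<Rightarrow> bool" where
  "letter_union (Sym a) = True"
| "letter_union (Plus a b) = (letter_union a \<and> letter_union b)"
| "letter_union _ = False"

fun sigma_star :: "nat \<Rightarrow> re \<Rightarrow> bool" where
  "sigma_star k (Star t) = (letter_union t \<and> sort (letter_list t) = [0..<k])"
| "sigma_star k _ = False"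

fun no_sigma_union :: "nat \<Rightarrow> re \<Rightarrow> bool" where
  "no_sigma_union k Eps = True"
| "no_sigma_union k (Sym a) = True"
| "no_sigma_union k (Plus a b) =
     (\<not> sigma_star k a \<and> \<not> sigma_star k b \<and> no_sigma_union k a \<and> no_sigma_union k b)"
| "no_sigma_union k (Conc a b) = (no_sigma_union k a \<and> no_sigma_union k b)"
| "no_sigma_union k (Star a) = no_sigma_union k a"

definition RE_na :: "nat \<Rightarrow> re set" where
  "RE_na k = {\<alpha>. re_over k \<alpha> \<and> no_sigma_union k \<alpha>}"

definition R_coeff :: "nat \<Rightarrow> nat \<Rightarrow> nat" where
  "R_coeff k n = card {\<alpha> \<in> RE_na k. re_size \<alpha> = n}"

definition L_coeff :: "nat \<Rightarrow> nat \<Rightarrow> nat" where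
  "L_coeff k n = (\<Sum>\<alpha> \<in> {\<alpha> \<in> RE_na k. re_size \<alpha> = n}. letters \<alpha>)"

end

theory Submission
  imports Defs "HOL-Complex_Analysis.Complex_Analysis" "HOL-Real_Asymp.Real_Asymp"
    "HOL-Combinatorics.Multiset_Permutations"
begin

text \<open>
  Let $T = s z^{2k}$ count the $\Sigma$-star expressions. Decomposing an expression at its root gives
  $R = (k+1)z + z(R-T)^2 + zR^2 + zR$, so $V := 1 - z + 2zT - 4zR$ is a square root of the
  polynomial $\Delta = (1-z+2zT)^2 - 8z^2(k+1+T^2)$. The corresponding linear equation for $L$ reads
  $2L = N/V + kT$ with a polynomial $N$, while $2V' = \Delta'/V$. Hence, up to finitely many terms,
  both $L_n$ and $n R_n$ are coefficients of a polynomial times $\Delta^{-1/2}$, and their quotient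
  tends to $-4N(\rho)/\Delta'(\rho)$ as soon as $\Delta$ has a unique and simple root $\rho$
  in some disc $|z| < r$ with $r > \rho > 0$.

  Since $s = k!\,C_{k-1} \le k!\,4^k/2$ is small compared with $(8k+8)^k$, the terms of $\Delta$ involving $T$ are a
  tiny perturbation of $(1-z)^2 - 8(k+1)z^2$ on the disc of radius $r = (8(k+1))^{-1/2}$. This locates
  $\rho$ between $r/(1+r)$ and $r$ for every $k \ge 2$ and makes $T(\rho)$ exponentially small in $k$.
\<close>

unbundle no vec_syntax

subsection \<open>The functional equations\<close>

text \<open>Bounding the size instead of fixing it makes the induction work: the operands of an
  expression of size at most \<open>Suc n\<close> lie in the set for \<open>n\<close>. Finiteness
  keeps sums and cardinalities over a layer from collapsing to the default value 0.\<close>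

lemma finite_re_over_le: "finite {\<alpha>. re_over k \<alpha> \<and> re_size \<alpha> \<le> n}"
proof (induction n)
  case 0
  have "re_size \<alpha> > 0" for \<alpha> by (cases \<alpha>) auto
  then have "{\<alpha>. re_over k \<alpha> \<and> re_size \<alpha> \<le> 0} = {}" by (auto simp: not_le)
  then show ?case by (simp only: finite.emptyI)
next
  case (Suc n)
  let ?F = "{\<alpha>. re_over k \<alpha> \<and> re_size \<alpha> \<le> n}"
  have "\<alpha> \<in> {Eps} \<union> Sym ` {..<k} \<union> (\<lambda>(a, b). Plus a b) ` (?F \<times> ?F)
          \<union> (\<lambda>(a, b). Conc a b) ` (?F \<times> ?F) \<union> Star ` ?F"
    if "re_over k \<alpha>" "re_size \<alpha> \<le> Suc n" for \<alpha>
    using that by (cases \<alpha>) auto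
  then have "{\<alpha>. re_over k \<alpha> \<and> re_size \<alpha> \<le> Suc n} \<subseteq>
      {Eps} \<union> Sym ` {..<k} \<union> (\<lambda>(a, b). Plus a b) ` (?F \<times> ?F)
          \<union> (\<lambda>(a, b). Conc a b) ` (?F \<times> ?F) \<union> Star ` ?F" by blast
  then show ?case
    by (rule finite_subset) (use Suc in auto)
qed

section \<open>Weighted generating functions of sets of expressions\<close>

text \<open>A variable weight treats both series at once: weight 1 yields R, weight
  \<open>letters\<close> yields L. The coefficients are complex because the singularity analysis
  takes place in a complex disc.\<close>

definition weight_gf :: "(re \<Rightarrow> complex) \<Rightarrow> re set \<Rightarrow> complex fps" where
  "weight_gf w A = Abs_fps (\<lambda>n. \<Sum>\<alpha> \<in> {\<alpha> \<in> A. re_size \<alpha> = n}. w \<alpha>)"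

lemma finite_layer: "A \<subseteq> Collect (re_over k) \<Longrightarrow> finite {\<alpha> \<in> A. re_size \<alpha> = n}"
  by (rule finite_subset[OF _ finite_re_over_le[of k n]]) auto

lemma weight_gf_Un:
  assumes "A \<subseteq> Collect (re_over k)" "B \<subseteq> Collect (re_over k)" "A \<inter> B = {}"
  shows "weight_gf w (A \<union> B) = weight_gf w A + weight_gf w B"
proof (rule fps_ext)
  fix n
  have "{\<alpha> \<in> A \<union> B. re_size \<alpha> = n} = {\<alpha> \<in> A. re_size \<alpha> = n} \<union> {\<alpha> \<in> B. re_size \<alpha> = n}"
    by auto
  then show "weight_gf w (A \<union> B) $ n = (weight_gf w A + weight_gf w B) $ n"
    unfolding weight_gf_def
    using assms finite_layer by (simp, subst sum.union_disjoint) auto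
qed

lemma weight_gf_Diff:
  assumes "A \<subseteq> Collect (re_over k)" "B \<subseteq> A"
  shows "weight_gf w (A - B) = weight_gf w A - weight_gf w B"
  using weight_gf_Un[of "A - B" k B w] assms by (simp add: Un_absorb2 subset_eq Int_commute)

lemma weight_gf_add: "weight_gf (\<lambda>\<alpha>. u \<alpha> + v \<alpha>) A = weight_gf u A + weight_gf v A"
  by (rule fps_ext) (simp add: weight_gf_def sum.distrib)

lemma weight_gf_Star: "weight_gf w (Star ` A) = fps_X * weight_gf (\<lambda>\<alpha>. w (Star \<alpha>)) A"
proof (rule fps_ext)
  fix n
  have "(\<Sum>\<alpha> \<in> {\<alpha> \<in> Star ` A. re_size \<alpha> = n}. w \<alpha>) =
      (if n = 0 then 0 else \<Sum>\<alpha> \<in> {\<alpha> \<in> A. re_size \<alpha> = n - 1}. w (Star \<alpha>))"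
  proof (cases n)
    case (Suc m)
    have "{\<alpha> \<in> Star ` A. re_size \<alpha> = n} = Star ` {\<alpha> \<in> A. re_size \<alpha> = m}" using Suc by auto
    then show ?thesis using Suc by (simp add: sum.reindex inj_on_def)
  next
    case 0
    then have e: "{\<alpha> \<in> Star ` A. re_size \<alpha> = n} = {}" by auto
    show ?thesis unfolding e using 0 by simp
  qed
  then show "weight_gf w (Star ` A) $ n = (fps_X * weight_gf (\<lambda>\<alpha>. w (Star \<alpha>)) A) $ n"
    by (simp add: weight_gf_def)
qed

text \<open>\<open>con\<close> stands for \<open>Plus\<close> or \<open>Conc\<close>. A weight that
  factors over the operands gives a Cauchy product, and the root symbol contributes the extra
  \<open>fps_X\<close>.\<close>

lemma weight_gf_binary:
  assumes "A \<subseteq> Collect (re_over k)" "B \<subseteq> Collect (re_over k)"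
    and size: "\<And>a b. re_size (con a b) = re_size a + re_size b + 1"
    and inj: "\<And>a b c d. con a b = con c d \<longleftrightarrow> a = c \<and> b = d"
    and w: "\<And>a b. w (con a b) = u a * v b"
  shows "weight_gf w ((\<lambda>(a, b). con a b) ` (A \<times> B)) = fps_X * (weight_gf u A * weight_gf v B)"
proof (rule fps_ext)
  fix n
  let ?C = "(\<lambda>(a, b). con a b) ` (A \<times> B)"
  let ?A = "\<lambda>i. {\<alpha> \<in> A. re_size \<alpha> = i}" and ?B = "\<lambda>i. {\<alpha> \<in> B. re_size \<alpha> = i}"
  show "weight_gf w ?C $ n = (fps_X * (weight_gf u A * weight_gf v B)) $ n"
  proof (cases n)
    case 0
    then have e: "{\<alpha> \<in> ?C. re_size \<alpha> = n} = {}" by (auto simp: size)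
    show ?thesis unfolding weight_gf_def fps_nth_Abs_fps e using 0 by simp
  next
    case (Suc m)
    \<comment> \<open>The layer is cut up by the size \<open>i\<close> of the left operand; the root
      symbol takes one unit of \<open>Suc m\<close>.\<close>
    have eq: "{\<alpha> \<in> ?C. re_size \<alpha> = n} = (\<lambda>(a, b). con a b) ` (\<Union>i\<in>{0..m}. ?A i \<times> ?B (m - i))"
      using Suc by (auto simp: size image_iff)
    have "(\<Sum>\<alpha> \<in> {\<alpha> \<in> ?C. re_size \<alpha> = n}. w \<alpha>) =
        (\<Sum>(a, b) \<in> (\<Union>i\<in>{0..m}. ?A i \<times> ?B (m - i)). u a * v b)"
      unfolding eq by (subst sum.reindex) (auto simp: inj_on_def inj w intro!: sum.cong)
    also have "\<dots> = (\<Sum>i = 0..m. \<Sum>(a, b) \<in> ?A i \<times> ?B (m - i). u a * v b)"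
      by (rule sum.UNION_disjoint) (use assms(1,2) finite_layer in auto)
    also have "\<dots> = (\<Sum>i = 0..m. (\<Sum>a \<in> ?A i. u a) * (\<Sum>b \<in> ?B (m - i). v b))"
      by (simp add: sum_product sum.cartesian_product)
    also have "\<dots> = (weight_gf u A * weight_gf v B) $ m"
      by (simp add: weight_gf_def fps_mult_nth)
    also have "\<dots> = (fps_X * (weight_gf u A * weight_gf v B)) $ n"
      using Suc by (simp add: fps_X_mult_nth del: fps_mult_nth)
    finally show ?thesis by (simp add: weight_gf_def)
  qed
qed

section \<open>Sigma-star expressions and the decomposition at the root\<close>

abbreviation sigma_stars :: "nat \<Rightarrow> re set" where
  "sigma_stars k \<equiv> Collect (sigma_star k)"

text \<open>A binary tree with m leaves has m - 1 inner nodes.\<close>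

lemma letter_union_size: "letter_union t \<Longrightarrow> re_size t + 1 = 2 * length (letter_list t)"
  by (induction t) auto

lemma letters_conv: "letters t = length (letter_list t)"
  by (induction t) auto

lemma re_over_conv: "re_over k t \<longleftrightarrow> set (letter_list t) \<subseteq> {..<k}"
  by (induction t) auto

text \<open>A union of letters contains no star at all. This places the Sigma-star expressions
  themselves in \<open>RE_na\<close>.\<close>

lemma letter_union_no_sigma:
  assumes "letter_union t"
  shows "\<not> sigma_star k t" "no_sigma_union k t"
proof -
  have *: "\<not> sigma_star k t" if "letter_union t" for t
    using that by (cases t) auto
  from assms show "\<not> sigma_star k t" by (rule *)
  from assms show "no_sigma_union k t" by (induction t) (auto simp: *)
qed

text \<open>With k letters, k - 1 unions and one star, all these expressions have the same size, so
  T is a single monomial.\<close>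

lemma sigma_star_props:
  assumes "sigma_star k \<alpha>"
  shows "re_size \<alpha> = 2 * k" "letters \<alpha> = k" "\<alpha> \<in> RE_na k"
proof -
  obtain t where t: "\<alpha> = Star t" "letter_union t" "sort (letter_list t) = [0..<k]"
    using assms by (cases \<alpha>) auto
  have "length (letter_list t) = k" "set (letter_list t) = {..<k}"
    using t(3) by (metis length_sort length_upt minus_nat.diff_0,
        metis set_sort set_upt lessThan_atLeast0)
  then show "re_size \<alpha> = 2 * k" "letters \<alpha> = k" "\<alpha> \<in> RE_na k"
    using letter_union_size[OF t(2)] letter_union_no_sigma[OF t(2)]
    by (auto simp: t(1) RE_na_def letters_conv re_over_conv)
qed

lemma RE_na_over: "RE_na k \<subseteq> Collect (re_over k)"
  by (auto simp: RE_na_def)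

lemma sigma_stars_subset: "sigma_stars k \<subseteq> RE_na k"
  using sigma_star_props(3) by auto

text \<open>Membership in \<open>RE_na\<close> passes to the operands, and an additional condition
  arises only at a root \<open>Plus\<close>, whose operands must avoid Sigma-star
  expressions.\<close>

lemma RE_na_decomp:
  "RE_na k = insert Eps (Sym ` {..<k}) \<union>
     ((\<lambda>(a, b). Plus a b) ` ((RE_na k - sigma_stars k) \<times> (RE_na k - sigma_stars k)) \<union>
     ((\<lambda>(a, b). Conc a b) ` (RE_na k \<times> RE_na k) \<union> Star ` RE_na k))"
  (is "_ = ?R")
proof (intro equalityI subsetI)
  fix \<alpha> assume "\<alpha> \<in> RE_na k"
  then show "\<alpha> \<in> ?R" by (cases \<alpha>) (auto simp: RE_na_def)
qed (auto simp: RE_na_def)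

lemma weight_gf_sigma_stars:
  assumes "\<And>\<alpha>. letters \<alpha> = k \<Longrightarrow> w \<alpha> = c"
  shows "weight_gf w (sigma_stars k) = fps_const (c * of_nat (card (sigma_stars k))) * fps_X ^ (2 * k)"
proof (rule fps_ext)
  fix n
  have "{\<alpha> \<in> sigma_stars k. re_size \<alpha> = n} = (if n = 2 * k then sigma_stars k else {})"
    using sigma_star_props(1) by auto
  moreover have "(\<Sum>\<alpha>\<in>sigma_stars k. w \<alpha>) = of_nat (card (sigma_stars k)) * c"
    using assms sigma_star_props(2) by simp
  ultimately show "weight_gf w (sigma_stars k) $ n =
      (fps_const (c * of_nat (card (sigma_stars k))) * fps_X ^ (2 * k)) $ n"
    by (simp add: weight_gf_def)
qed

lemma weight_gf_atoms:
  assumes "w Eps = c" "\<And>a. w (Sym a) = d"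
  shows "weight_gf w (insert Eps (Sym ` {..<k})) = fps_const (c + of_nat k * d) * fps_X"
proof (rule fps_ext)
  fix n
  have "{\<alpha> \<in> insert Eps (Sym ` {..<k}). re_size \<alpha> = n}
      = (if n = 1 then insert Eps (Sym ` {..<k}) else {})" by auto
  moreover have "(\<Sum>\<alpha>\<in>insert Eps (Sym ` {..<k}). w \<alpha>) = c + of_nat k * d"
    by (subst sum.insert) (auto simp: assms sum.reindex inj_on_def)
  ultimately show "weight_gf w (insert Eps (Sym ` {..<k})) $ n = (fps_const (c + of_nat k * d) * fps_X) $ n"
    by (simp add: weight_gf_def)
qed

lemma weight_gf_RE_na_decomp:
  "weight_gf w (RE_na k) = weight_gf w (insert Eps (Sym ` {..<k})) +
     (weight_gf w ((\<lambda>(a, b). Plus a b) ` ((RE_na k - sigma_stars k) \<times> (RE_na k - sigma_stars k))) +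
     (weight_gf w ((\<lambda>(a, b). Conc a b) ` (RE_na k \<times> RE_na k)) + weight_gf w (Star ` RE_na k)))"
  by (subst RE_na_decomp, (subst weight_gf_Un[of _ k]; (force simp: RE_na_def)?)+)

section \<open>The equations for R and L\<close>

definition R_gf :: "nat \<Rightarrow> complex fps" where
  "R_gf k = Abs_fps (\<lambda>n. of_nat (R_coeff k n))"

definition L_gf :: "nat \<Rightarrow> complex fps" where
  "L_gf k = Abs_fps (\<lambda>n. of_nat (L_coeff k n))"

definition T_gf :: "nat \<Rightarrow> complex fps" where
  "T_gf k = fps_const (of_nat (card (sigma_stars k))) * fps_X ^ (2 * k)"

lemma R_gf_conv: "R_gf k = weight_gf (\<lambda>_. 1) (RE_na k)"
  by (simp add: R_gf_def weight_gf_def R_coeff_def)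

lemma L_gf_conv: "L_gf k = weight_gf (\<lambda>\<alpha>. of_nat (letters \<alpha>)) (RE_na k)"
  by (simp add: L_gf_def weight_gf_def L_coeff_def)

lemma R_gf_eq:
  "R_gf k = fps_const (1 + of_nat k) * fps_X + fps_X * (R_gf k - T_gf k)\<^sup>2 + fps_X * (R_gf k)\<^sup>2
     + fps_X * R_gf k"
  (is "_ = ?rhs")
proof -
  have T: "weight_gf (\<lambda>_. 1) (sigma_stars k) = T_gf k"
    by (subst weight_gf_sigma_stars[of _ _ 1]) (auto simp: T_gf_def)
  have D: "weight_gf (\<lambda>_. 1) (RE_na k - sigma_stars k) = R_gf k - T_gf k"
    by (subst weight_gf_Diff[OF RE_na_over sigma_stars_subset]) (simp add: T R_gf_conv)
  let ?w = "\<lambda>_. 1 :: complex"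
  have "weight_gf ?w ((\<lambda>(a, b). Plus a b) ` ((RE_na k - sigma_stars k) \<times> (RE_na k - sigma_stars k))) =
      fps_X * (R_gf k - T_gf k)\<^sup>2"
    unfolding D[symmetric] power2_eq_square
    by (rule weight_gf_binary[where k = k]) (use RE_na_over in auto)
  moreover have "weight_gf ?w ((\<lambda>(a, b). Conc a b) ` (RE_na k \<times> RE_na k)) = fps_X * (R_gf k)\<^sup>2"
    unfolding R_gf_conv power2_eq_square
    by (rule weight_gf_binary[where k = k]) (use RE_na_over in auto)
  moreover have "weight_gf ?w (Star ` RE_na k) = fps_X * R_gf k"
    by (simp only: weight_gf_Star R_gf_conv)
  moreover have "weight_gf ?w (insert Eps (Sym ` {..<k})) = fps_const (1 + of_nat k) * fps_X"
    by (subst weight_gf_atoms[of _ 1 1]) simp_all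
  ultimately have "weight_gf ?w (RE_na k) = ?rhs"
    by (subst weight_gf_RE_na_decomp) (simp only: add.assoc)
  then show ?thesis by (simp only: R_gf_conv)
qed

text \<open>The number of letters is additive, so it does not factor as
  \<open>weight_gf_binary\<close> demands. It is split into the letters of the left operand and
  those of the right one; each part factors with 1 on the other operand, and both give the same
  product.\<close>

lemma weight_gf_letters_binary:
  assumes "A \<subseteq> Collect (re_over k)"
    and "\<And>a b. re_size (con a b) = re_size a + re_size b + 1"
    and "\<And>a b c d. con a b = con c d \<longleftrightarrow> a = c \<and> b = d"
    and "\<And>a b. letters (con a b) = letters a + letters b"
  shows "weight_gf (\<lambda>\<alpha>. of_nat (letters \<alpha>)) ((\<lambda>(a, b). con a b) ` (A \<times> A)) =
    2 * fps_X * weight_gf (\<lambda>_. 1) A * weight_gf (\<lambda>\<alpha>. of_nat (letters \<alpha>)) A"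
proof -
  let ?P = "(\<lambda>(a, b). con a b) ` (A \<times> A)"
  \<comment> \<open>By injectivity of \<open>con\<close>, \<open>THE\<close> recovers the operand,
    so that each part becomes a weight on whole expressions.\<close>
  define l where "l \<gamma> = letters (THE a. \<exists>b. \<gamma> = con a b)" for \<gamma>
  define m where "m \<gamma> = letters (THE b. \<exists>a. \<gamma> = con a b)" for \<gamma>
  have [simp]: "l (con a b) = letters a" "m (con a b) = letters b" for a b
    by (auto simp: l_def m_def assms(3))
  have "weight_gf (\<lambda>\<alpha>. of_nat (letters \<alpha>)) ?P = weight_gf (\<lambda>\<alpha>. of_nat (l \<alpha>) + of_nat (m \<alpha>)) ?P"
    unfolding weight_gf_def by (intro arg_cong[where f = Abs_fps] ext sum.cong) (auto simp: assms(4))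
  also have "\<dots> = weight_gf (\<lambda>\<alpha>. of_nat (l \<alpha>)) ?P + weight_gf (\<lambda>\<alpha>. of_nat (m \<alpha>)) ?P"
    by (rule weight_gf_add)
  also have "weight_gf (\<lambda>\<alpha>. of_nat (l \<alpha>)) ?P =
      fps_X * (weight_gf (\<lambda>\<alpha>. of_nat (letters \<alpha>)) A * weight_gf (\<lambda>_. 1) A)"
    by (rule weight_gf_binary[where k = k]) (use assms in auto)
  also have "weight_gf (\<lambda>\<alpha>. of_nat (m \<alpha>)) ?P =
      fps_X * (weight_gf (\<lambda>_. 1) A * weight_gf (\<lambda>\<alpha>. of_nat (letters \<alpha>)) A)"
    by (rule weight_gf_binary[where k = k]) (use assms in auto)
  finally show ?thesis by (simp add: algebra_simps)
qed

lemma L_gf_eq: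
  "L_gf k = of_nat k * fps_X + 2 * fps_X * (R_gf k - T_gf k) * (L_gf k - of_nat k * T_gf k)
     + 2 * fps_X * R_gf k * L_gf k + fps_X * L_gf k"
  (is "_ = ?rhs")
proof -
  let ?l = "\<lambda>\<alpha>. of_nat (letters \<alpha>) :: complex"
  have T: "weight_gf (\<lambda>_. 1) (sigma_stars k) = T_gf k"
    by (subst weight_gf_sigma_stars[of _ _ 1]) (auto simp: T_gf_def)
  have T': "weight_gf ?l (sigma_stars k) = of_nat k * T_gf k"
    by (subst weight_gf_sigma_stars[of _ _ "of_nat k"])
       (auto simp: T_gf_def fps_of_nat simp flip: fps_const_mult)
  have D: "weight_gf (\<lambda>_. 1) (RE_na k - sigma_stars k) = R_gf k - T_gf k"
    "weight_gf ?l (RE_na k - sigma_stars k) = L_gf k - of_nat k * T_gf k"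
    by (subst weight_gf_Diff[OF RE_na_over sigma_stars_subset]; simp add: T T' R_gf_conv L_gf_conv)+
  have "weight_gf ?l ((\<lambda>(a, b). Plus a b) ` ((RE_na k - sigma_stars k) \<times> (RE_na k - sigma_stars k))) =
      2 * fps_X * (R_gf k - T_gf k) * (L_gf k - of_nat k * T_gf k)"
    unfolding D[symmetric] by (rule weight_gf_letters_binary[where k = k]) (use RE_na_over in auto)
  moreover have "weight_gf ?l ((\<lambda>(a, b). Conc a b) ` (RE_na k \<times> RE_na k)) = 2 * fps_X * R_gf k * L_gf k"
    unfolding R_gf_conv L_gf_conv
    by (rule weight_gf_letters_binary[where k = k]) (use RE_na_over in auto)
  moreover have "weight_gf ?l (Star ` RE_na k) = fps_X * L_gf k"
    by (simp only: weight_gf_Star L_gf_conv letters.simps)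
  moreover have "weight_gf ?l (insert Eps (Sym ` {..<k})) = of_nat k * fps_X"
    by (subst weight_gf_atoms[of _ 0 1]) (simp_all add: fps_of_nat)
  ultimately have "weight_gf ?l (RE_na k) = ?rhs"
    by (subst weight_gf_RE_na_decomp) (simp only: add.assoc)
  then show ?thesis by (simp only: L_gf_conv)
qed

section \<open>A bound for the number of Sigma-star expressions\<close>

text \<open>Preorder code of a union tree: True at an inner node, False at a leaf.\<close>

fun shape :: "re \<Rightarrow> bool list" where
  "shape (Plus a b) = True # shape a @ shape b"
| "shape _ = [False]"

text \<open>The preorder code is prefix-free. The arbitrary tails allow the first subtree to be
  split off before the induction continues with the second.\<close>

lemma shape_letter_list_inj:
  assumes "letter_union t" "letter_union t'"
    "shape t @ u = shape t' @ u'" "letter_list t @ w = letter_list t' @ w'"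
  shows "t = t' \<and> u = u' \<and> w = w'"
  using assms
proof (induction t arbitrary: t' u u' w w')
  case (Sym a)
  then show ?case by (cases t') simp_all
next
  case (Plus a b)
  obtain a' b' where t': "t' = Plus a' b'"
    using Plus.prems(2,3) by (cases t') auto
  have "a = a' \<and> shape b @ u = shape b' @ u' \<and> letter_list b @ w = letter_list b' @ w'"
    using Plus.prems t' by (intro Plus.IH(1)) auto
  moreover from this have "b = b' \<and> u = u' \<and> w = w'"
    using Plus.prems t' by (intro Plus.IH(2)) auto
  ultimately show ?case using t' by simp
qed auto

lemma length_shape: "letter_union t \<Longrightarrow> length (shape t) + 1 = 2 * length (letter_list t)"
  by (induction t) auto

text \<open>A union of letters is determined by its code, a word of length 2k - 1 over two symbols,
  and by the order of its letters. This crude count replaces the Catalan number.\<close>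

lemma card_sigma_stars: "2 * card (sigma_stars k) \<le> 4 ^ k * fact k"
proof (cases "k = 0")
  \<comment> \<open>Treated apart because \<open>2 * k - 1\<close> is truncated here; a Sigma-star
    expression would have size 0, so there is none.\<close>
  case True
  have "sigma_stars k = {}"
  proof (intro equals0I)
    fix \<alpha> assume "\<alpha> \<in> sigma_stars k"
    then have "re_size \<alpha> = 0" using sigma_star_props(1)[of k \<alpha>] True by auto
    then show False by (cases \<alpha>) auto
  qed
  then have "card (sigma_stars k) = 0" by (simp only: card.empty)
  then show ?thesis by simp
next
  case False
  let ?S = "{t. letter_union t \<and> sort (letter_list t) = [0..<k]}"
  let ?B = "{xs :: bool list. set xs \<subseteq> UNIV \<and> length xs = 2 * k - 1} \<times> {xs. set xs = {..<k} \<and> distinct xs}"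
  have "sigma_stars k = Star ` ?S"
  proof (intro equalityI subsetI)
    fix \<alpha> assume "\<alpha> \<in> sigma_stars k"
    then show "\<alpha> \<in> Star ` ?S" by (cases \<alpha>) auto
  qed auto
  then have "card (sigma_stars k) = card ?S" by (simp add: card_image inj_on_def)
  also have "\<dots> \<le> card ?B"
  proof (rule card_inj_on_le)
    show "inj_on (\<lambda>t. (shape t, letter_list t)) ?S"
      by (rule inj_onI) (use shape_letter_list_inj[of _ _ "[]" "[]" "[]" "[]"] in simp)
    show "(\<lambda>t. (shape t, letter_list t)) ` ?S \<subseteq> ?B"
    proof (intro image_subsetI)
      fix t assume "t \<in> ?S"
      then have t: "letter_union t" "sort (letter_list t) = [0..<k]" by auto
      have "length (letter_list t) = length [0..<k]" by (metis t(2) length_sort)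
      moreover have "set (letter_list t) = set [0..<k]" by (metis t(2) set_sort)
      moreover have "distinct (letter_list t)" by (metis t(2) distinct_sort distinct_upt)
      ultimately show "(shape t, letter_list t) \<in> ?B"
        using length_shape[OF t(1)] by (auto simp: lessThan_atLeast0)
    qed
    have "finite {xs. set xs = {..<k} \<and> distinct xs}"
      by (rule finite_subset[OF _ finite_subset_distinct[of "{..<k}"]]) auto
    then show "finite ?B" by (intro finite_cartesian_product finite_lists_length_eq) simp
  qed
  also have "card ?B = 2 ^ (2 * k - 1) * fact k"
    unfolding card_cartesian_product permutations_of_set_def[symmetric]
    by (subst card_lists_length_eq) simp_all
  finally have "2 * card (sigma_stars k) \<le> 2 * 2 ^ (2 * k - 1) * fact k" by simp
  also have "2 * 2 ^ (2 * k - 1) = (4 :: nat) ^ k"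
    using False by (cases k) (simp_all add: power_mult)
  finally show ?thesis .
qed

subsection \<open>Coefficients of inverse square roots\<close>

text \<open>The coefficients of $(1 - x)^{-1/2}$, that is $\binom{2n}{n} 4^{-n}$.\<close>
primrec cbin :: "nat \<Rightarrow> real" where
  "cbin 0 = 1"
| "cbin (Suc n) = cbin n * (2 * real n + 1) / (2 * real n + 2)"

lemma cbin_pos: "cbin n > 0"
  by (induction n) auto

lemma cbin_gbinomial: "of_real (cbin n) = (-1) ^ n * ((-1/2 :: complex) gchoose n)"
proof (induction n)
  case (Suc n)
  have "of_nat (Suc n) * ((-1/2 :: complex) gchoose Suc n) = (-1/2 - of_nat n) * ((-1/2) gchoose n)"
    using gbinomial_mult_1[of "-1/2 :: complex" n] by (simp add: algebra_simps)
  then have "((-1/2 :: complex) gchoose Suc n) = (-1/2 - of_nat n) * ((-1/2) gchoose n) / of_nat (Suc n)"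
    by (metis nonzero_mult_div_cancel_left of_nat_neq_0)
  then have "(-1) ^ Suc n * ((-1/2 :: complex) gchoose Suc n)
      = ((-1) ^ n * ((-1/2) gchoose n)) * ((1/2 + of_nat n) / of_nat (Suc n))"
    by (simp add: field_simps)
  also have "\<dots> = of_real (cbin n) * ((1/2 + of_nat n) / of_nat (Suc n))"
    by (simp only: Suc)
  also have "(1/2 + of_nat n) / of_nat (Suc n) = (2 * of_nat n + 1) / (2 * of_nat n + 2 :: complex)"
  proof -
    have "of_nat (Suc n) \<noteq> (0 :: complex)" by (rule of_nat_neq_0)
    moreover from this have "2 * of_nat n + 2 \<noteq> (0 :: complex)"
      by (metis mult_2 mult_eq_0_iff of_nat_Suc add.commute distrib_left mult.right_neutral zero_neq_numeral)
    ultimately show ?thesis by (simp add: divide_simps) (simp add: algebra_simps)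
  qed
  finally show ?case by simp
qed simp

definition inv_sqrt_gf :: "complex \<Rightarrow> complex fps" where
  "inv_sqrt_gf c = Abs_fps (\<lambda>n. c ^ n * of_real (cbin n))"

text \<open>The binomial series with exponent -1/2 squares to the one with exponent -1, which is
  1/(1 + X); then -cX is substituted for X.\<close>

lemma inv_sqrt_gf_square: "(inv_sqrt_gf c)\<^sup>2 * (1 - fps_const c * fps_X) = 1"
proof -
  let ?y = "fps_const (- c) * fps_X"
  have y0: "?y $ 0 = 0" by simp
  have "inv_sqrt_gf c = fps_compose (fps_binomial (-1/2)) ?y"
    unfolding fps_compose_linear inv_sqrt_gf_def
    by (rule fps_ext) (simp add: cbin_gbinomial flip: power_mult_distrib mult.assoc)
  then have "(inv_sqrt_gf c)\<^sup>2 = fps_compose (fps_binomial (-1/2) ^ 2) ?y"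
    by (simp only: power2_eq_square fps_compose_mult_distrib[OF y0])
  also have "fps_binomial (-1/2 :: complex) ^ 2 = inverse (1 + fps_X)"
    by (simp add: fps_binomial_power fps_binomial_minus_one)
  finally have "(inv_sqrt_gf c)\<^sup>2 * (1 - fps_const c * fps_X) =
      fps_compose (inverse (1 + fps_X)) ?y * (1 - fps_const c * fps_X)" by simp
  also have "fps_compose (inverse (1 + fps_X)) ?y * (1 - fps_const c * fps_X) =
      fps_compose (inverse (1 + fps_X)) ?y * fps_compose (1 + fps_X) ?y"
    by (simp add: fps_compose_add_distrib fps_X_fps_compose_startby0)
  also have "\<dots> = fps_compose (inverse (1 + fps_X) * (1 + fps_X)) ?y"
    by (simp only: fps_compose_mult_distrib[OF y0])
  also have "inverse (1 + fps_X) * (1 + fps_X) = (1 :: complex fps)"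
    by (rule inverse_mult_eq_1) simp
  finally show ?thesis by simp
qed

section \<open>Coefficient asymptotics of products with an inverse square root\<close>

text \<open>The linear factor is uniform in \<open>m\<close> and supplies the dominating sequence
  for Tannery's theorem.\<close>

lemma cbin_le: "cbin m \<le> (2 * real i + 1) * cbin (m + i)"
proof (induction i)
  case (Suc i)
  have "(2 * real i + 1) * (2 * real (m + i) + 2) \<le> (2 * real i + 3) * (2 * real (m + i) + 1)"
    by (simp add: algebra_simps)
  then have "(2 * real i + 1) \<le> (2 * real i + 3) * ((2 * real (m + i) + 1) / (2 * real (m + i) + 2))"
    by (simp add: field_simps)
  then have "(2 * real i + 1) * cbin (m + i)
      \<le> (2 * real i + 3) * ((2 * real (m + i) + 1) / (2 * real (m + i) + 2)) * cbin (m + i)"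
    by (rule mult_right_mono) (simp add: cbin_pos less_imp_le)
  with Suc show ?case by (simp add: algebra_simps)
qed simp

lemma cbin_ratio: "(\<lambda>n. cbin n / cbin (n + i)) \<longlonglongrightarrow> 1"
proof (induction i)
  case 0
  then show ?case using cbin_pos by (simp add: less_imp_neq[symmetric])
next
  case (Suc i)
  have "(\<lambda>n. cbin n / cbin (n + i) * ((2 * real (n + i) + 2) / (2 * real (n + i) + 1))) \<longlonglongrightarrow> 1 * 1"
  proof (intro tendsto_mult Suc)
    have "(\<lambda>n. 1 + inverse (real n)) \<longlonglongrightarrow> 1 + 0"
      by (intro tendsto_intros LIMSEQ_inverse_real_of_nat lim_inverse_n)
    then have "(\<lambda>n. 1 + inverse (real (Suc (2 * (n + i))))) \<longlonglongrightarrow> 1 + 0"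
      by (rule LIMSEQ_subseq_LIMSEQ[where f = "\<lambda>n. Suc (2 * (n + i))", unfolded o_def])
         (auto simp: strict_mono_def)
    moreover have "1 + inverse (real (Suc (2 * (n + i)))) = (2 * real (n + i) + 2) / (2 * real (n + i) + 1)" for n
      by (simp add: field_simps)
    ultimately show "(\<lambda>n. (2 * real (n + i) + 2) / (2 * real (n + i) + 1)) \<longlonglongrightarrow> 1" by simp
  qed
  moreover have "cbin n / cbin (n + i) * ((2 * real (n + i) + 2) / (2 * real (n + i) + 1)) = cbin n / cbin (n + Suc i)" for n
    by (simp add: field_simps)
  ultimately show ?case by (simp only: mult_1)
qed

text \<open>For fixed \<open>i\<close> the quotient of \<open>cbin (n - i)\<close> by
  \<open>cbin n\<close> tends to 1, so dominated termwise passage to the limit leaves the sum of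
  \<open>b\<close>.\<close>

lemma cbin_convolution_limit:
  fixes b :: "nat \<Rightarrow> complex"
  assumes "summable (\<lambda>i. (2 * real i + 1) * norm (b i))"
  shows "(\<lambda>n. (\<Sum>i\<le>n. b i * of_real (cbin (n - i))) / of_real (cbin n)) \<longlonglongrightarrow> suminf b"
proof -
  \<comment> \<open>Extension by zero beyond \<open>n\<close> turns the finite sums into series over
    a fixed index set.\<close>
  define a where "a i n = (if i \<le> n then b i * of_real (cbin (n - i) / cbin n) else 0)" for i n
  have "(\<lambda>n. suminf (\<lambda>i. a i n)) \<longlonglongrightarrow> suminf b"
  proof (rule tannerys_theorem[THEN conjunct2, THEN conjunct2])
    show "summable (\<lambda>i. (2 * real i + 1) * norm (b i))" by fact
    show "(\<lambda>n. a i n) \<longlonglongrightarrow> b i" for i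
    proof (rule LIMSEQ_offset[of _ i])
      have "(\<lambda>n. b i * of_real (cbin n / cbin (n + i))) \<longlonglongrightarrow> b i * of_real 1"
        by (intro tendsto_intros cbin_ratio)
      then show "(\<lambda>n. a i (n + i)) \<longlonglongrightarrow> b i" by (simp add: a_def)
    qed
    have "norm (a i n) \<le> (2 * real i + 1) * norm (b i)" for i n
    proof (cases "i \<le> n")
      case True
      then have "cbin (n - i) / cbin n \<le> 2 * real i + 1"
        using cbin_le[of "n - i" i] cbin_pos[of n] by (simp add: divide_simps)
      then have "norm (b i) * (cbin (n - i) / cbin n) \<le> norm (b i) * (2 * real i + 1)"
        by (intro mult_left_mono) auto
      then show ?thesis using True cbin_pos[of n] cbin_pos[of "n - i"]
        by (simp add: a_def norm_mult norm_divide mult.commute)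
    qed (simp add: a_def)
    then show "eventually (\<lambda>(i, n). norm (a i n) \<le> (2 * real i + 1) * norm (b i)) (at_top \<times>\<^sub>F sequentially)"
      by (intro always_eventually) auto
  qed auto
  moreover have "suminf (\<lambda>i. a i n) = (\<Sum>i\<le>n. b i * of_real (cbin (n - i))) / of_real (cbin n)" for n
  proof -
    have "suminf (\<lambda>i. a i n) = (\<Sum>i\<le>n. a i n)"
      by (rule suminf_finite) (auto simp: a_def)
    then show ?thesis by (simp add: a_def sum_divide_distrib)
  qed
  ultimately show ?thesis by simp
qed

text \<open>Scaling by \<open>\<rho> ^ n\<close> reduces the coefficients of the inverse square root
  to \<open>cbin n\<close>, which leaves a convolution with the terms of G at
  \<open>\<rho>\<close>.\<close>

lemma inv_sqrt_gf_mult_limit: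
  fixes G :: "complex fps" and \<rho> :: real
  assumes "\<rho> > 0" "ereal \<rho> < fps_conv_radius G"
  shows "(\<lambda>n. (inv_sqrt_gf (1 / of_real \<rho>) * G) $ n * of_real \<rho> ^ n / of_real (cbin n))
           \<longlonglongrightarrow> eval_fps G (of_real \<rho>)"
proof -
  define b where "b i = G $ i * of_real \<rho> ^ i" for i
  have 1: "summable (\<lambda>i. norm (b i))"
    unfolding b_def by (rule norm_summable_fps) (use assms in auto)
  \<comment> \<open>Absolute convergence of G' at \<open>\<rho>\<close> accounts for the factor
    \<open>real i\<close> in the required summability.\<close>
  have "summable (\<lambda>i. norm (fps_deriv G $ i * of_real \<rho> ^ i))"
    by (rule norm_summable_fps) (use assms fps_conv_radius_deriv[of G] in \<open>auto intro: less_le_trans\<close>)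
  then have "summable (\<lambda>i. \<rho> * norm (fps_deriv G $ i * of_real \<rho> ^ i))"
    by (rule summable_mult)
  also have "(\<lambda>i. \<rho> * norm (fps_deriv G $ i * of_real \<rho> ^ i)) = (\<lambda>i. real (Suc i) * norm (b (Suc i)))"
    using assms(1) by (intro ext) (simp add: b_def norm_mult norm_power mult_ac del: of_nat_Suc)
  finally have 2: "summable (\<lambda>i. real i * norm (b i))"
    by (subst (asm) summable_Suc_iff)
  have "summable (\<lambda>i. 2 * (real i * norm (b i)) + norm (b i))"
    by (intro summable_add summable_mult 1 2)
  then have "summable (\<lambda>i. (2 * real i + 1) * norm (b i))" by (simp add: algebra_simps)
  from cbin_convolution_limit[OF this]
  have "(\<lambda>n. (\<Sum>i\<le>n. b i * of_real (cbin (n - i))) / of_real (cbin n)) \<longlonglongrightarrow> eval_fps G (of_real \<rho>)"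
    by (simp add: b_def eval_fps_def)
  moreover have "(\<Sum>i\<le>n. b i * of_real (cbin (n - i))) = (inv_sqrt_gf (1 / of_real \<rho>) * G) $ n * of_real \<rho> ^ n" for n
  proof -
    have "b i * of_real (cbin (n - i)) = G $ i * inv_sqrt_gf (1 / of_real \<rho>) $ (n - i) * of_real \<rho> ^ n"
      if "i \<le> n" for i
    proof -
      have "(of_real \<rho> :: complex) ^ n = of_real \<rho> ^ i * of_real \<rho> ^ (n - i)"
        using that by (simp flip: power_add)
      then show ?thesis using assms(1) by (simp add: b_def inv_sqrt_gf_def field_simps)
    qed
    then have "(\<Sum>i\<le>n. b i * of_real (cbin (n - i)))
        = (\<Sum>i\<le>n. G $ i * inv_sqrt_gf (1 / of_real \<rho>) $ (n - i) * of_real \<rho> ^ n)"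
      by (intro sum.cong) auto
    also have "\<dots> = (G * inv_sqrt_gf (1 / of_real \<rho>)) $ n * of_real \<rho> ^ n"
      by (simp add: fps_mult_nth atLeast0AtMost sum_distrib_right)
    finally show ?thesis by (simp only: mult.commute)
  qed
  ultimately show ?thesis by simp
qed

text \<open>A disc is contractible, so the zero-free function 1/H has a holomorphic square root on
  it, whose Taylor series converges on the whole disc.\<close>

lemma holomorphic_fps_inv_sqrt:
  fixes H :: "complex poly"
  assumes "r > 0" "\<And>z. norm z < r \<Longrightarrow> poly H z \<noteq> 0"
  obtains F where "ereal r \<le> fps_conv_radius F" "F\<^sup>2 * fps_of_poly H = 1"
proof -
  have "(\<lambda>z. inverse (poly H z)) holomorphic_on ball 0 r"
    using assms(2) by (intro holomorphic_intros) auto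
  moreover have "contractible (ball (0 :: complex) r)"
    by (intro convex_imp_contractible convex_ball)
  ultimately obtain g where g: "g holomorphic_on ball 0 r"
    and g2: "\<And>z. z \<in> ball 0 r \<Longrightarrow> inverse (poly H z) = g z ^ 2"
    using contractible_imp_holomorphic_sqrt[of "\<lambda>z. inverse (poly H z)" "ball 0 r"] assms(2)
    by (metis inverse_nonzero_iff_nonzero mem_ball_0)
  let ?F = "fps_expansion g 0"
  from g have g': "g holomorphic_on eball 0 (ereal r)" by simp
  note R = conv_radius_fps_expansion[OF g']
  have "(\<lambda>z. g z ^ 2 * poly H z) has_fps_expansion ?F ^ 2 * fps_of_poly H"
  proof (intro fps_expansion_intros)
    show "g has_fps_expansion ?F"
      using g assms(1) by (intro has_fps_expansion_fps_expansion[of "ball 0 r"]) auto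
    show "poly H has_fps_expansion fps_of_poly H"
    proof -
      have "eval_fps (fps_of_poly H) = poly H" by (rule ext) simp
      then show ?thesis using eval_fps_has_fps_expansion[of "fps_of_poly H"] by simp
    qed
  qed
  moreover have "eventually (\<lambda>z. z \<in> ball (0 :: complex) r) (nhds 0)"
    using assms(1) by (intro eventually_nhds_in_open) auto
  then have "eventually (\<lambda>z. g z ^ 2 * poly H z = 1) (nhds 0)"
    by eventually_elim (use assms(2) in \<open>simp flip: g2\<close>)
  ultimately have "(\<lambda>z. 1) has_fps_expansion ?F ^ 2 * fps_of_poly H"
    using has_fps_expansion_cong by fast
  then have "?F ^ 2 * fps_of_poly H = 1"
    using fps_expansion_unique_complex fps_expansion_intros(1) has_fps_expansion_1 by blast
  with R that show ?thesis by blast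
qed

text \<open>Write D = (1 - z/rho) H with H zero-free in the disc. Up to sign, 1/V is the explicit
  series of (1 - z/rho)^(-1/2) times an analytic F with F^2 H = 1. The sign, the growth of the
  coefficients and the value F(rho) all cancel in the quotient.\<close>

lemma inv_sqrt_coeff_ratio_limit:
  fixes D A B :: "complex poly" and V :: "complex fps" and \<rho> r :: real
  assumes "0 < \<rho>" "\<rho> < r" and V: "V\<^sup>2 = fps_of_poly D" "V $ 0 \<noteq> 0"
    and root: "poly D (of_real \<rho>) = 0" and simple: "poly (pderiv D) (of_real \<rho>) \<noteq> 0"
    and unique: "\<And>z. norm z < r \<Longrightarrow> poly D z = 0 \<Longrightarrow> z = of_real \<rho>"
    and B: "poly B (of_real \<rho>) \<noteq> 0"
  shows "(\<lambda>n. (fps_of_poly A * inverse V) $ n / (fps_of_poly B * inverse V) $ n)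
           \<longlonglongrightarrow> poly A (of_real \<rho>) / poly B (of_real \<rho>)"
proof -
  let ?\<rho> = "of_real \<rho> :: complex"
  have [simp]: "?\<rho> \<noteq> 0" using assms(1) by simp
  obtain K where K: "D = [:-?\<rho>, 1:] * K" using root by (auto simp: poly_eq_0_iff_dvd)
  define H where "H = smult (-?\<rho>) K"
  have "[:-?\<rho>, 1:] = smult (-?\<rho>) [:1, -1/?\<rho>:]" using assms(1) by simp
  then have D: "D = [:1, -1/?\<rho>:] * H"
    unfolding K H_def by (simp only: mult_smult_left mult_smult_right)
  have nz: "poly H z \<noteq> 0" if "norm z < r" for z
  proof
    assume 0: "poly H z = 0"
    then have "poly D z = 0" by (simp add: D)
    with unique that have "z = ?\<rho>" by blast
    \<comment> \<open>By the product rule, a zero of H at \<open>\<rho>\<close> would make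
      \<open>\<rho>\<close> a multiple root of D.\<close>
    moreover have "poly (pderiv D) ?\<rho> = poly [:1, -1/?\<rho>:] ?\<rho> * poly (pderiv H) ?\<rho>
        + poly H ?\<rho> * poly (pderiv [:1, -1/?\<rho>:]) ?\<rho>"
      unfolding D by (simp only: pderiv_mult poly_add poly_mult)
    ultimately show False using 0 simple assms(1) by (simp add: pderiv_pCons)
  qed
  have "r > 0" using assms(1,2) by simp
  obtain F where F: "ereal r \<le> fps_conv_radius F" "F\<^sup>2 * fps_of_poly H = 1"
    by (rule holomorphic_fps_inv_sqrt[OF \<open>r > 0\<close> nz])
  let ?C = "inv_sqrt_gf (1 / ?\<rho>)"
  have \<rho>F: "ereal \<rho> < fps_conv_radius F"
    using F(1) assms(2) by (meson ereal_less_eq(3) less_ereal.simps(1) less_le_trans)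
  have "eval_fps (F ^ 2 * fps_of_poly H) ?\<rho> = (eval_fps F ?\<rho>)\<^sup>2 * poly H ?\<rho>"
  proof (subst eval_fps_mult)
    show "ereal (norm ?\<rho>) < fps_conv_radius (F\<^sup>2)"
      using \<rho>F assms(1) fps_conv_radius_power[of F 2] by auto
  qed (use \<rho>F assms(1) in \<open>auto simp: eval_fps_power\<close>)
  then have F\<rho>: "eval_fps F ?\<rho> \<noteq> 0" by (auto simp: F(2))
  have lin: "fps_of_poly [:1, -1/?\<rho>:] = 1 - fps_const (1 / ?\<rho>) * fps_X"
    by (simp only: fps_of_poly_linear' minus_divide_left[symmetric] fps_const_neg[symmetric]
        mult_minus_left add_uminus_conv_diff)
  have "(?C * F)\<^sup>2 * fps_of_poly D = (?C\<^sup>2 * (1 - fps_const (1 / ?\<rho>) * fps_X)) * (F\<^sup>2 * fps_of_poly H)"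
    unfolding D fps_of_poly_mult lin by (simp add: algebra_simps power_mult_distrib)
  also have "\<dots> = 1" by (simp add: inv_sqrt_gf_square F)
  finally have "(?C * F * V)\<^sup>2 = 1" by (simp add: V(1) power_mult_distrib)
  \<comment> \<open>Complex formal power series form an integral domain, so a square root of 1 is 1
    or -1.\<close>
  then have "?C * F * V = 1 \<or> ?C * F * V = -1" by (simp add: power2_eq_1_iff)
  moreover have iv: "V * inverse V = 1" using V(2) by (simp add: inverse_mult_eq_1')
  ultimately have W: "inverse V = ?C * F \<or> inverse V = - (?C * F)"
  proof (elim disjE)
    assume 1: "?C * F * V = 1"
    have "?C * F = ?C * F * V * inverse V" by (simp only: mult.assoc iv mult_1_right)
    also note 1
    finally show ?thesis by simp
  next
    assume 1: "?C * F * V = -1"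
    have "?C * F = ?C * F * V * inverse V" by (simp only: mult.assoc iv mult_1_right)
    also note 1
    finally show ?thesis by simp
  qed
  have lim: "(\<lambda>n. (?C * (fps_of_poly P * F)) $ n * ?\<rho> ^ n / of_real (cbin n)) \<longlonglongrightarrow> poly P ?\<rho> * eval_fps F ?\<rho>" for P
  proof -
    have "ereal \<rho> < fps_conv_radius (fps_of_poly P * F)"
      using \<rho>F fps_conv_radius_mult[of "fps_of_poly P" F] by (auto intro: less_le_trans)
    from inv_sqrt_gf_mult_limit[OF assms(1) this] show ?thesis
      using \<rho>F assms(1) by (simp add: eval_fps_mult)
  qed
  have "(\<lambda>n. ((?C * (fps_of_poly A * F)) $ n * ?\<rho> ^ n / of_real (cbin n)) /
             ((?C * (fps_of_poly B * F)) $ n * ?\<rho> ^ n / of_real (cbin n)))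
      \<longlonglongrightarrow> (poly A ?\<rho> * eval_fps F ?\<rho>) / (poly B ?\<rho> * eval_fps F ?\<rho>)"
    using B F\<rho> by (intro tendsto_divide lim) auto
  moreover have "((?C * (fps_of_poly A * F)) $ n * ?\<rho> ^ n / of_real (cbin n)) /
             ((?C * (fps_of_poly B * F)) $ n * ?\<rho> ^ n / of_real (cbin n)) =
      (fps_of_poly A * inverse V) $ n / (fps_of_poly B * inverse V) $ n" for n
  proof -
    have nz: "?\<rho> ^ n / complex_of_real (cbin n) \<noteq> 0" using cbin_pos[of n] assms(1) by simp
    have e: "fps_of_poly P * (?C * F) = ?C * (fps_of_poly P * F)" for P
      by (simp only: mult.left_commute)
    from W have "(fps_of_poly A * inverse V) $ n / (fps_of_poly B * inverse V) $ n =
        (?C * (fps_of_poly A * F)) $ n / (?C * (fps_of_poly B * F)) $ n"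
      by (elim disjE) (simp_all only: e mult_minus_right fps_neg_nth minus_divide_divide)
    also have "\<dots> = ((?C * (fps_of_poly A * F)) $ n * (?\<rho> ^ n / of_real (cbin n))) /
             ((?C * (fps_of_poly B * F)) $ n * (?\<rho> ^ n / of_real (cbin n)))"
      by (rule nonzero_mult_divide_mult_cancel_right[symmetric, OF nz])
    finally show ?thesis by (simp only: times_divide_eq_right)
  qed
  ultimately show ?thesis using F\<rho> by simp
qed

subsection \<open>The dominant root of the discriminant\<close>

text \<open>Delta expanded with T = s z^(2k): 8k + 7 is 8(k + 1) - 1, and 4 z^2 T^2 combines with -8
  z^2 T^2.\<close>

definition disc_poly :: "nat \<Rightarrow> real \<Rightarrow> complex poly" where
  "disc_poly k s = [:1, -2, - of_nat (8 * k + 7):] + monom (of_real (4 * s)) (2 * k + 1)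
     - monom (of_real (4 * s)) (2 * k + 2) - monom (of_real (4 * s\<^sup>2)) (4 * k + 2)"

text \<open>The mean value inequality for powers, obtained by peeling off one factor at a
  time.\<close>

lemma norm_power_diff_le:
  fixes z w :: complex
  assumes "norm z \<le> r" "norm w \<le> r"
  shows "norm (z ^ n - w ^ n) \<le> real n * r ^ (n - 1) * norm (z - w)"
proof (induction n)
  case (Suc n)
  have "0 \<le> r" using assms(1) norm_ge_zero order_trans by blast
  have "z ^ Suc n - w ^ Suc n = z * (z ^ n - w ^ n) + (z - w) * w ^ n"
    by (simp add: algebra_simps)
  then have "norm (z ^ Suc n - w ^ Suc n) \<le> norm z * norm (z ^ n - w ^ n) + norm (z - w) * norm w ^ n"
    by (metis norm_mult norm_power norm_triangle_ineq)
  also have "\<dots> \<le> r * (real n * r ^ (n - 1) * norm (z - w)) + norm (z - w) * r ^ n"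
    using assms \<open>0 \<le> r\<close> Suc by (intro add_mono mult_mono power_mono mult_nonneg_nonneg) auto
  also have "\<dots> = real (Suc n) * r ^ n * norm (z - w)"
    by (cases n) (simp_all add: algebra_simps)
  finally show ?case by simp
qed simp

text \<open>\<open>s\<close> stands for the number of Sigma-star expressions. The factor
  \<open>real k + 1\<close> in \<open>small\<close> pays for the exponents that differences of
  powers bring down, and 1/12 is what \<open>sigma_star_mass\<close> gives at k = 2.\<close>

locale small_disc =
  fixes k :: nat and s r :: real
  assumes k2: "k \<ge> 2" and s0: "s \<ge> 0" and r0: "r > 0"
    and r_eq: "8 * (real k + 1) * r\<^sup>2 = 1"
    and small: "s * r ^ (2 * k) * (real k + 1) \<le> 1 / 12"
begin

text \<open>The value T(r), which bounds |T| on the closed disc of radius \<open>r\<close>.\<close>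

definition \<tau> :: real where "\<tau> = s * r ^ (2 * k)"

text \<open>The part of Delta that involves T, namely 4zT(1 - z) - 4z^2 T^2.\<close>

definition pert :: "complex \<Rightarrow> complex" where
  "pert z = of_real (4 * s) * z ^ (2 * k + 1) - of_real (4 * s) * z ^ (2 * k + 2)
     - of_real (4 * s\<^sup>2) * z ^ (4 * k + 2)"

lemma poly_disc: "poly (disc_poly k s) z = 1 - 2 * z - of_nat (8 * k + 7) * z\<^sup>2 + pert z"
  by (simp add: disc_poly_def pert_def poly_monom power2_eq_square algebra_simps del: of_nat_add of_nat_mult)

lemma r_le: "r \<le> 1 / 4"
proof (rule ccontr)
  assume "\<not> r \<le> 1 / 4"
  then have "1 / 16 < r\<^sup>2" using power_strict_mono[of "1/4" r 2] by (simp add: power2_eq_square)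
  moreover have "24 * r\<^sup>2 \<le> 8 * (real k + 1) * r\<^sup>2" using k2 by (intro mult_right_mono) auto
  ultimately show False using r_eq by simp
qed

lemma tau_nonneg: "0 \<le> \<tau>"
  using s0 r0 by (simp add: \<tau>_def)

lemma tau_small: "\<tau> * (real k + 1) \<le> 1 / 12" "\<tau> \<le> 1 / 36"
proof -
  show *: "\<tau> * (real k + 1) \<le> 1 / 12" using small by (simp add: \<tau>_def)
  have "\<tau> * 3 \<le> \<tau> * (real k + 1)" using k2 tau_nonneg by (intro mult_left_mono) auto
  with * show "\<tau> \<le> 1 / 36" by simp
qed

lemma tau_powers:
  "s * r ^ (2 * k + 1) = \<tau> * r" "s * r ^ (2 * k + 2) = \<tau> * r\<^sup>2" "s\<^sup>2 * r ^ (4 * k + 2) = \<tau>\<^sup>2 * r\<^sup>2"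
  "s\<^sup>2 * r ^ (4 * k + 1) = \<tau>\<^sup>2 * r"
proof -
  have "r ^ (4 * k) = (r ^ (2 * k))\<^sup>2" by (simp flip: power_mult)
  then show "s * r ^ (2 * k + 1) = \<tau> * r" "s * r ^ (2 * k + 2) = \<tau> * r\<^sup>2" "s\<^sup>2 * r ^ (4 * k + 2) = \<tau>\<^sup>2 * r\<^sup>2"
    "s\<^sup>2 * r ^ (4 * k + 1) = \<tau>\<^sup>2 * r"
    by (simp_all add: \<tau>_def power_add power2_eq_square mult_ac)
qed

section \<open>Bounds for the perturbation\<close>

text \<open>Every term carries a factor z and a factor T, which gives 4 \<open>\<tau>\<close> (1 + r
  + r \<open>\<tau>\<close>) r; the bracket is below 2 and \<open>\<tau>\<close> is at most
  1/36.\<close>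

lemma norm_pert_less:
  assumes "norm z \<le> r"
  shows "norm (pert z) < r"
proof -
  have pw: "norm z ^ n \<le> r ^ n" for n using assms by (intro power_mono) auto
  have "norm (pert z) \<le> 4 * s * norm z ^ (2 * k + 1) + 4 * s * norm z ^ (2 * k + 2) + 4 * s\<^sup>2 * norm z ^ (4 * k + 2)"
    unfolding pert_def
    by (rule norm_triangle_le_diff, rule add_mono, rule norm_triangle_le_diff, rule add_mono)
       (use s0 in \<open>simp_all add: norm_mult norm_power del: power_Suc power_Suc2\<close>)
  also have "\<dots> \<le> 4 * s * r ^ (2 * k + 1) + 4 * s * r ^ (2 * k + 2) + 4 * s\<^sup>2 * r ^ (4 * k + 2)"
    using s0 by (intro add_mono mult_left_mono pw) auto
  also have "\<dots> = 4 * (s * r ^ (2 * k + 1)) + 4 * (s * r ^ (2 * k + 2)) + 4 * (s\<^sup>2 * r ^ (4 * k + 2))"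
    by (simp only: mult.assoc)
  also have "\<dots> = 4 * \<tau> * (1 + r + r * \<tau>) * r"
    unfolding tau_powers by (simp add: algebra_simps power2_eq_square)
  also have "\<dots> < 1 * r"
  proof (rule mult_strict_right_mono[OF _ r0])
    have "r * \<tau> \<le> 1/4 * (1/36)" using r_le tau_small(2) r0 tau_nonneg by (intro mult_mono) auto
    then have "4 * \<tau> * (1 + r + r * \<tau>) \<le> 4 * (1/36) * 2"
      using tau_small(2) tau_nonneg r_le r0 by (intro mult_mono) auto
    then show "4 * \<tau> * (1 + r + r * \<tau>) < 1" by simp
  qed
  finally show ?thesis by simp
qed

text \<open>The Lipschitz constant 1 is set against the factor of modulus at least 2 that the
  quadratic part provides in \<open>root_unique\<close>.\<close>

lemma norm_pert_diff_le:
  assumes "norm z \<le> r" "norm w \<le> r"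
  shows "norm (pert z - pert w) \<le> norm (z - w)"
proof -
  let ?d = "norm (z - w)"
  note pd = norm_power_diff_le[OF assms]
  have eq: "pert z - pert w = of_real (4 * s) * (z ^ (2 * k + 1) - w ^ (2 * k + 1))
      - of_real (4 * s) * (z ^ (2 * k + 2) - w ^ (2 * k + 2)) - of_real (4 * s\<^sup>2) * (z ^ (4 * k + 2) - w ^ (4 * k + 2))"
    unfolding pert_def by (simp only: algebra_simps)
  have "norm (pert z - pert w) \<le> 4 * s * norm (z ^ (2 * k + 1) - w ^ (2 * k + 1))
      + 4 * s * norm (z ^ (2 * k + 2) - w ^ (2 * k + 2)) + 4 * s\<^sup>2 * norm (z ^ (4 * k + 2) - w ^ (4 * k + 2))"
    unfolding eq
    by (rule norm_triangle_le_diff, rule add_mono, rule norm_triangle_le_diff, rule add_mono)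
       (use s0 in \<open>simp_all add: norm_mult norm_power del: power_Suc power_Suc2 power_add\<close>)
  also have "\<dots> \<le> 4 * s * (real (2 * k + 1) * r ^ (2 * k + 1 - 1) * ?d)
      + 4 * s * (real (2 * k + 2) * r ^ (2 * k + 2 - 1) * ?d) + 4 * s\<^sup>2 * (real (4 * k + 2) * r ^ (4 * k + 2 - 1) * ?d)"
    using s0 by (intro add_mono mult_left_mono pd) auto
  also have "\<dots> = (4 * real (2 * k + 1) * (s * r ^ (2 * k)) + 4 * real (2 * k + 2) * (s * r ^ (2 * k + 1))
      + 4 * real (4 * k + 2) * (s\<^sup>2 * r ^ (4 * k + 1))) * ?d"
  proof -
    have "2 * k + 1 - 1 = 2 * k" "2 * k + 2 - 1 = 2 * k + 1" "4 * k + 2 - 1 = 4 * k + 1" by auto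
    then show ?thesis by (simp only: algebra_simps)
  qed
  also have "\<dots> = (4 * real (2 * k + 1) * \<tau> + 4 * real (2 * k + 2) * (\<tau> * r) + 4 * real (4 * k + 2) * (\<tau>\<^sup>2 * r)) * ?d"
    unfolding tau_powers \<tau>_def[symmetric] ..
  also have "\<dots> \<le> 1 * ?d"
  proof (rule mult_right_mono)
    \<comment> \<open>Each exponent is bounded by a multiple of k + 1, leaving 1/12 times 8 + 2 +
      1/9, which is below 1.\<close>
    have "4 * real (2 * k + 1) * \<tau> + 4 * real (2 * k + 2) * (\<tau> * r) + 4 * real (4 * k + 2) * (\<tau>\<^sup>2 * r)
        \<le> 4 * (2 * (real k + 1)) * \<tau> + 4 * (2 * (real k + 1)) * (\<tau> * r) + 4 * (4 * (real k + 1)) * (\<tau>\<^sup>2 * r)"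
      using tau_nonneg r0 by (intro add_mono mult_right_mono mult_left_mono) auto
    also have "\<dots> = (\<tau> * (real k + 1)) * (8 + 8 * r + 16 * (\<tau> * r))"
      by (simp add: algebra_simps power2_eq_square)
    also have "\<dots> \<le> 1/12 * (8 + 8 * (1/4) + 16 * (1/36 * (1/4)))"
      using tau_small tau_nonneg r0 r_le
      by (intro mult_mono add_mono order_refl) auto
    also have "\<dots> \<le> 1" by simp
    finally show "4 * real (2 * k + 1) * \<tau> + 4 * real (2 * k + 2) * (\<tau> * r) + 4 * real (4 * k + 2) * (\<tau>\<^sup>2 * r) \<le> 1" .
  qed simp
  finally show ?thesis by simp
qed

text \<open>Since 8(k + 1) = 1/r^2, the quadratic is the difference of squares (1 - z)^2 - (z/r)^2.
  Its roots are r/(1 + r) and -r/(1 - r), the latter outside the disc.\<close>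

lemma unperturbed_factor:
  "1 - 2 * z - of_nat (8 * k + 7) * z\<^sup>2 = (1 - of_real (1 / r + 1) * z) * (1 + of_real (1 / r - 1) * z :: complex)"
proof -
  have "8 * real k + 7 = (1 / r + 1) * (1 / r - 1)"
    using r_eq r0 by (simp add: field_simps power2_eq_square)
  then have "complex_of_real (8 * real k + 7) = of_real (1 / r + 1) * of_real (1 / r - 1)"
    by (simp only: of_real_mult)
  then have *: "of_nat (8 * k + 7) = complex_of_real (1 / r + 1) * of_real (1 / r - 1)" by simp
  show ?thesis unfolding * by (simp add: algebra_simps power2_eq_square)
qed

section \<open>Uniqueness, existence and simplicity of the root\<close>

text \<open>In the left half of the disc the first factor has real part at least 1 and the second
  has modulus at least 1 - (1/r - 1) r = r, so \<open>pert\<close>, of modulus below r, cannot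
  cancel their product.\<close>

lemma no_root_left:
  assumes "norm z \<le> r" "Re z < 0"
  shows "poly (disc_poly k s) z \<noteq> 0"
proof
  assume "poly (disc_poly k s) z = 0"
  then have eq: "(1 - of_real (1 / r + 1) * z) * (1 + of_real (1 / r - 1) * z) = - pert z"
    unfolding poly_disc unperturbed_factor by (simp add: eq_neg_iff_add_eq_0)
  have "1 \<le> Re (1 - of_real (1 / r + 1) * z)"
    using assms(2) r0 by (simp add: mult_nonneg_nonpos)
  also have "\<dots> \<le> norm (1 - of_real (1 / r + 1) * z)" by (rule complex_Re_le_cmod)
  finally have 1: "1 \<le> norm (1 - of_real (1 / r + 1) * z)" .
  have "norm (of_real (1 / r - 1) * z) \<le> (1 / r - 1) * r"
  proof -
    have "1 / r - 1 \<ge> 0" using r_le r0 by simp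
    moreover have "norm (of_real (1 / r - 1) * z) = \<bar>1 / r - 1\<bar> * norm z"
      by (simp only: norm_mult norm_of_real)
    ultimately show ?thesis using assms(1) by (simp add: mult_left_mono del: diff_ge_0_iff_ge)
  qed
  also have "\<dots> = 1 - r" using r0 by (simp add: algebra_simps)
  finally have 2: "r \<le> norm (1 + of_real (1 / r - 1) * z)"
    using norm_triangle_ineq2[of 1 "- (of_real (1 / r - 1) * z)"] by (simp del: of_real_diff of_real_divide)
  have "1 * r \<le> norm (1 - of_real (1 / r + 1) * z) * norm (1 + of_real (1 / r - 1) * z)"
    using 1 2 r0 by (intro mult_mono) auto
  also have "\<dots> = norm (pert z)" by (simp only: eq norm_minus_cancel flip: norm_mult)
  finally show False using norm_pert_less[OF assms(1)] by simp
qed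

text \<open>Both roots lie in the right half-plane, so between them the quadratic part changes by z
  - w times a factor of real part at least 2, while \<open>pert\<close> changes by at most |z -
  w|.\<close>

lemma root_unique:
  assumes "norm z \<le> r" "norm w \<le> r" "poly (disc_poly k s) z = 0" "poly (disc_poly k s) w = 0"
  shows "z = w"
proof (rule ccontr)
  assume "z \<noteq> w"
  have re: "Re z \<ge> 0" "Re w \<ge> 0" using no_root_left assms by force+
  have "0 = poly (disc_poly k s) z - poly (disc_poly k s) w" using assms by simp
  also have "\<dots> = pert z - pert w - (z - w) * (2 + of_nat (8 * k + 7) * (z + w))"
    unfolding poly_disc by (simp add: algebra_simps power2_eq_square)
  finally have "(z - w) * (2 + of_nat (8 * k + 7) * (z + w)) = pert z - pert w"
    by (metis right_minus_eq)
  then have "norm (z - w) * norm (2 + of_nat (8 * k + 7) * (z + w)) = norm (pert z - pert w)"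
    by (metis norm_mult)
  also have "\<dots> \<le> norm (z - w) * 1" using norm_pert_diff_le[OF assms(1,2)] by simp
  finally have "norm (2 + of_nat (8 * k + 7) * (z + w)) \<le> 1"
    using \<open>z \<noteq> w\<close> by (simp del: of_nat_add of_nat_mult)
  moreover have "2 \<le> Re (2 + of_nat (8 * k + 7) * (z + w))" using re by simp
  ultimately show False using complex_Re_le_cmod[of "2 + of_nat (8 * k + 7) * (z + w)"] by linarith
qed

definition real_disc :: "real \<Rightarrow> real" where
  "real_disc x = 1 - 2 * x - (8 * real k + 7) * x\<^sup>2 + 4 * s * x ^ (2 * k + 1)
     - 4 * s * x ^ (2 * k + 2) - 4 * s\<^sup>2 * x ^ (4 * k + 2)"

lemma poly_disc_of_real: "poly (disc_poly k s) (of_real x) = of_real (real_disc x)"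
  unfolding poly_disc pert_def real_disc_def by simp

text \<open>Expressed through the value \<open>s * x ^ (2 * k)\<close> of T, so that bounds on T
  apply directly and the denominator of \<open>ell_at\<close> appears.\<close>

definition real_disc_deriv :: "real \<Rightarrow> real" where
  "real_disc_deriv x = - 2 - 2 * (8 * real k + 7) * x + 4 * (s * x ^ (2 * k)) * (2 * real k + 1)
     - 4 * (s * x ^ (2 * k)) * (2 * real k + 2) * x - 4 * (s * x ^ (2 * k))\<^sup>2 * (4 * real k + 2) * x"

lemma poly_pderiv_disc_of_real:
  "poly (pderiv (disc_poly k s)) (of_real x) = of_real (real_disc_deriv x)"
proof -
  have "complex_of_real x ^ (4 * k) = (of_real x ^ (2 * k))\<^sup>2" by (simp flip: power_mult)
  then show ?thesis
    unfolding disc_poly_def real_disc_deriv_def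
    by (simp add: pderiv_add pderiv_diff pderiv_monom pderiv_pCons poly_monom algebra_simps power2_eq_square)
qed

text \<open>Intermediate value theorem: at r/(1 + r) the quadratic part vanishes and the
  perturbation is nonnegative; at r the quadratic part is -r(2 - r), at most -r, which the
  perturbation cannot offset.\<close>

lemma ex_root: "\<exists>\<rho>. r / (1 + r) \<le> \<rho> \<and> \<rho> < r \<and> real_disc \<rho> = 0"
proof -
  define x where "x = r / (1 + r)"
  have x: "0 < x" "x < r" using r0 r_le by (auto simp: x_def field_simps)
  define t where "t = s * x ^ (2 * k)"
  have t: "0 \<le> t" "t \<le> \<tau>"
    using s0 x by (auto simp: t_def \<tau>_def intro!: mult_left_mono power_mono)
  have "1 - 2 * x - (8 * real k + 7) * x\<^sup>2 = 0"
  proof -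
    have "8 * real k + 7 = (1 / r + 1) * (1 / r - 1)"
      using r_eq r0 by (simp add: field_simps power2_eq_square)
    moreover have "(1 / r + 1) * x = 1" 
      using r0 add_pos_pos[OF r0 mult_pos_pos[OF r0 r0]] by (simp add: x_def field_simps)
    ultimately have "(8 * real k + 7) * x\<^sup>2 = (1 / r - 1) * x"
      by (metis mult.assoc mult.commute mult.right_neutral power2_eq_square)
    also have "\<dots> = (1 / r + 1) * x - 2 * x" by (simp add: algebra_simps)
    finally show ?thesis using \<open>(1 / r + 1) * x = 1\<close> by simp
  qed
  moreover have "x ^ (4 * k) = (x ^ (2 * k))\<^sup>2" by (simp flip: power_mult)
  ultimately have "real_disc x = 4 * t * x * (1 - x - x * t)"
    unfolding real_disc_def t_def by (simp add: power_add power2_eq_square algebra_simps)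
  moreover have "x + x * t \<le> 1/4 + 1/4 * 1"
    using x t r_le tau_small(2) by (intro add_mono mult_mono) auto
  ultimately have 1: "real_disc x \<ge> 0" using t x by simp
  have "real_disc r < 0"
  proof -
    have "norm (complex_of_real r) \<le> r" using r0 by simp
    from norm_pert_less[OF this] have "norm (pert (of_real r)) < r" .
    moreover have "complex_of_real (real_disc r) = (1 - of_real (1 / r + 1) * of_real r) * (1 + of_real (1 / r - 1) * of_real r) + pert (of_real r)"
      using poly_disc_of_real[of r] unfolding poly_disc unperturbed_factor by simp
    then have "pert (of_real r) = of_real (real_disc r - (1 - (1 / r + 1) * r) * (1 + (1 / r - 1) * r))"
      by (simp only: of_real_diff of_real_mult of_real_add of_real_1) (simp add: algebra_simps)
    moreover have "(1 - (1 / r + 1) * r) * (1 + (1 / r - 1) * r) = - r * (2 - r)"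
      using r0 by (simp add: field_simps)
    ultimately have "\<bar>real_disc r + r * (2 - r)\<bar> < r" by (simp del: of_real_add of_real_diff of_real_mult)
    moreover have "r * 1 \<le> r * (2 - r)" using r0 r_le by (intro mult_left_mono) auto
    ultimately show ?thesis by linarith
  qed
  moreover have "continuous_on {x..r} real_disc"
    unfolding real_disc_def by (intro continuous_intros)
  ultimately obtain \<rho> where \<rho>: "x \<le> \<rho>" "\<rho> \<le> r" "real_disc \<rho> = 0"
    using IVT2'[of real_disc r 0 x] 1 x by auto
  then have "\<rho> \<noteq> r" using \<open>real_disc r < 0\<close> by auto
  with \<rho> show ?thesis by (auto simp: x_def intro!: exI[of _ \<rho>])
qed

text \<open>The only positive contribution, 4T(2k + 1), is at most 8/12 and loses against the
  constant -2. This makes the root simple.\<close>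

lemma real_disc_deriv_neg:
  assumes "0 < x" "x < r"
  shows "real_disc_deriv x < 0"
proof -
  define t where "t = s * x ^ (2 * k)"
  have t: "0 \<le> t" "t \<le> \<tau>"
    using s0 assms by (auto simp: t_def \<tau>_def intro!: mult_left_mono power_mono)
  have "4 * t * (2 * real k + 1) \<le> 4 * \<tau> * (2 * (real k + 1))"
    using t by (intro mult_mono) auto
  also have "\<dots> = 8 * (\<tau> * (real k + 1))" by simp
  also have "\<dots> \<le> 8 * (1 / 12)" by (intro mult_left_mono tau_small) auto
  finally have "4 * t * (2 * real k + 1) \<le> 8 / 12" by simp
  moreover have "0 \<le> 4 * t * (2 * real k + 2) * x" "0 \<le> 4 * t\<^sup>2 * (4 * real k + 2) * x"
    "0 \<le> 2 * (8 * real k + 7) * x"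
    using t assms by auto
  ultimately show ?thesis unfolding real_disc_deriv_def t_def[symmetric] by linarith
qed

end

subsection \<open>The asymptotic ratio\<close>

text \<open>Completing the square in the quadratic equation for R: the two sides differ by 8X times
  the defect of that equation.\<close>

lemma square_discriminant:
  fixes X T R c :: "'a :: comm_ring_1"
  assumes "R = c * X + X * (R - T)\<^sup>2 + X * R\<^sup>2 + X * R"
  shows "(1 - X + 2 * X * T - 4 * X * R)\<^sup>2 = (1 - X + 2 * X * T)\<^sup>2 - 8 * X\<^sup>2 * (c + T\<^sup>2)"
proof -
  have "(1 - X + 2 * X * T - 4 * X * R)\<^sup>2 - ((1 - X + 2 * X * T)\<^sup>2 - 8 * X\<^sup>2 * (c + T\<^sup>2))
      = 8 * X * (c * X + X * (R - T)\<^sup>2 + X * R\<^sup>2 + X * R - R)"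
    by (simp add: power2_eq_square algebra_simps)
  also have "\<dots> = 0" using assms by simp
  finally show ?thesis by simp
qed

text \<open>Collecting the terms in L gives it the coefficient V = 1 - X + 2XT - 4XR; the remaining
  R is eliminated through 4XR = 1 - X + 2XT - V.\<close>

lemma linear_in_discriminant_root:
  fixes X T R L c :: "'a :: comm_ring_1"
  assumes "L = c * X + 2 * X * (R - T) * (L - c * T) + 2 * X * R * L + X * L"
  shows "2 * L * (1 - X + 2 * X * T - 4 * X * R)
     = 2 * c * X + 2 * c * X * T\<^sup>2 - c * T + c * T * X + c * T * (1 - X + 2 * X * T - 4 * X * R)"
proof -
  have "2 * L * (1 - X + 2 * X * T - 4 * X * R)
     - (2 * c * X + 2 * c * X * T\<^sup>2 - c * T + c * T * X + c * T * (1 - X + 2 * X * T - 4 * X * R))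
     = 2 * (L - (c * X + 2 * X * (R - T) * (L - c * T) + 2 * X * R * L + X * L))"
    by (simp add: power2_eq_square algebra_simps)
  also have "\<dots> = 0" using assms by simp
  finally show ?thesis by simp
qed

definition V_gf :: "nat \<Rightarrow> complex fps" where
  "V_gf k = 1 - fps_X + 2 * fps_X * T_gf k - 4 * fps_X * R_gf k"

lemma T_gf_conv: "T_gf k = of_nat (card (sigma_stars k)) * fps_X ^ (2 * k)"
  by (simp add: T_gf_def fps_of_nat)

lemma X_powers:
  fixes X :: "'a :: comm_ring_1"
  shows "X ^ (2 * k + 1) = X * X ^ (2 * k)" "X ^ (2 * k + 2) = X * X * X ^ (2 * k)"
    "X ^ (4 * k + 2) = X * X * (X ^ (2 * k) * X ^ (2 * k))" "X ^ (4 * k + 1) = X * (X ^ (2 * k) * X ^ (2 * k))"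
proof -
  have "X ^ (4 * k) = X ^ (2 * k) * X ^ (2 * k)" by (simp flip: power_add)
  then show "X ^ (2 * k + 1) = X * X ^ (2 * k)" "X ^ (2 * k + 2) = X * X * X ^ (2 * k)"
    "X ^ (4 * k + 2) = X * X * (X ^ (2 * k) * X ^ (2 * k))" "X ^ (4 * k + 1) = X * (X ^ (2 * k) * X ^ (2 * k))"
    by (simp_all add: mult_ac)
qed

lemma fps_of_poly_disc:
  "fps_of_poly (disc_poly k (real s)) =
     (1 - fps_X + 2 * fps_X * (of_nat s * fps_X ^ (2 * k)))\<^sup>2
       - 8 * fps_X\<^sup>2 * (of_nat (Suc k) + (of_nat s * fps_X ^ (2 * k))\<^sup>2)"
proof -
  have c: "complex_of_real (4 * real s) = of_nat (4 * s)" "complex_of_real (4 * (real s)\<^sup>2) = of_nat (4 * s\<^sup>2)"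
    by simp_all
  have "[:1, -2, - of_nat (8 * k + 7):] = 1 - monom 2 1 - monom (of_nat (8 * k + 7) :: complex) 2"
    by (simp add: monom_altdef numeral_2_eq_2 one_pCons)
  then have "fps_of_poly [:1, -2, - of_nat (8 * k + 7):] = 1 - 2 * fps_X - of_nat (8 * k + 7) * (fps_X :: complex fps)\<^sup>2"
    by (simp only: fps_of_poly_diff fps_of_poly_1 fps_of_poly_monom fps_of_nat numeral_fps_const power_one_right)
  then show ?thesis
    unfolding disc_poly_def fps_of_poly_add fps_of_poly_diff c fps_of_poly_monom fps_of_nat X_powers
    by (simp only: of_nat_mult of_nat_add of_nat_numeral of_nat_power of_nat_Suc) (simp add: power2_eq_square algebra_simps)
qed

lemma V_gf_square: "(V_gf k)\<^sup>2 = fps_of_poly (disc_poly k (real (card (sigma_stars k))))"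
proof -
  have "fps_const (1 + of_nat k) = (of_nat (Suc k) :: complex fps)" by (simp flip: fps_of_nat)
  then show ?thesis
    using square_discriminant[of "R_gf k" "of_nat (Suc k)" fps_X "T_gf k"] R_gf_eq[of k]
    unfolding fps_of_poly_disc V_gf_def T_gf_conv[symmetric] by simp
qed

text \<open>The numerator N = k(2z - T + zT + 2zT^2) with T = s z^(2k).\<close>

definition num_poly :: "nat \<Rightarrow> real \<Rightarrow> complex poly" where
  "num_poly k s = monom (of_nat (2 * k)) 1 - monom (of_nat k * of_real s) (2 * k)
     + monom (of_nat k * of_real s) (2 * k + 1) + monom (of_nat (2 * k) * of_real s ^ 2) (4 * k + 1)"

lemma L_gf_V_gf:
  "2 * L_gf k * V_gf k = fps_of_poly (num_poly k (real (card (sigma_stars k)))) + of_nat k * T_gf k * V_gf k"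
proof -
  let ?s = "card (sigma_stars k)"
  have c: "of_nat k * complex_of_real (real ?s) = of_nat (k * ?s)"
    "of_nat (2 * k) * complex_of_real (real ?s) ^ 2 = of_nat (2 * k * ?s\<^sup>2)" by simp_all
  have "fps_of_poly (num_poly k (real ?s)) =
     2 * of_nat k * fps_X + 2 * of_nat k * fps_X * (T_gf k)\<^sup>2 - of_nat k * T_gf k + of_nat k * T_gf k * fps_X"
    unfolding num_poly_def fps_of_poly_add fps_of_poly_diff c fps_of_poly_monom fps_of_nat T_gf_conv X_powers
    by (simp add: power2_eq_square algebra_simps)
  then show ?thesis
    using linear_in_discriminant_root[OF L_gf_eq] unfolding V_gf_def by simp
qed

lemma V_gf_0: "V_gf k $ 0 = 1"
  by (simp add: V_gf_def)

lemma T_gf_nth: "n > 2 * k \<Longrightarrow> T_gf k $ n = 0"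
  by (simp add: T_gf_def)

lemma fps_numeral_mult_nth:
  fixes f :: "complex fps"
  shows "(numeral m * f) $ n = numeral m * f $ n"
  by (simp add: numeral_fps_const)

text \<open>Beyond degree 2k + 1 only the summand -4zR of V survives; its factor z causes the index
  shift.\<close>

lemma V_gf_Suc: "n > 2 * k \<Longrightarrow> V_gf k $ Suc n = - 4 * of_nat (R_coeff k n)"
proof -
  assume n: "n > 2 * k"
  then show ?thesis
    by (simp add: V_gf_def R_gf_def T_gf_nth mult.assoc fps_numeral_mult_nth)
qed

text \<open>The quotient -4N/Delta' with \<open>t\<close> in place of T(x). As a separate argument,
  \<open>t\<close> lets the limit in k rest on bounds for \<open>t\<close> and \<open>x\<close>
  alone.\<close>

definition ell_at :: "nat \<Rightarrow> real \<Rightarrow> real \<Rightarrow> real" where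
  "ell_at k t x = - 4 * (2 * k * x - k * t + k * t * x + 2 * k * t\<^sup>2 * x) /
     (- 2 - 2 * (8 * real k + 7) * x + 4 * t * (2 * real k + 1)
       - 4 * t * (2 * real k + 2) * x - 4 * t\<^sup>2 * (4 * real k + 2) * x)"

lemma ratio_limit:
  assumes "small_disc k (real (card (sigma_stars k))) r"
  shows "\<exists>\<rho>. r / (1 + r) \<le> \<rho> \<and> \<rho> < r \<and>
    (\<lambda>n. real (L_coeff k n) / (real n * real (R_coeff k n)))
      \<longlonglongrightarrow> ell_at k (real (card (sigma_stars k)) * \<rho> ^ (2 * k)) \<rho>"
proof -
  define s where "s = real (card (sigma_stars k))"
  interpret small_disc k s r using assms by (simp add: s_def)
  obtain \<rho> where \<rho>: "r / (1 + r) \<le> \<rho>" "\<rho> < r" "real_disc \<rho> = 0" using ex_root by blast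
  have "0 < r / (1 + r)" using r0 by simp
  then have \<rho>0: "0 < \<rho>" using \<rho>(1) by linarith
  let ?\<rho> = "complex_of_real \<rho>"
  let ?D = "disc_poly k s" and ?N = "num_poly k s"
  have root: "poly ?D ?\<rho> = 0" by (simp add: poly_disc_of_real \<rho>)
  have deriv: "real_disc_deriv \<rho> < 0" by (rule real_disc_deriv_neg[OF \<rho>0 \<rho>(2)])
  then have simple: "poly (pderiv ?D) ?\<rho> \<noteq> 0" by (simp add: poly_pderiv_disc_of_real)
  have uniq: "z = ?\<rho>" if "norm z < r" "poly ?D z = 0" for z
    using root_unique[of z ?\<rho>] that root \<rho> \<rho>0 by simp
  have V0: "V_gf k $ 0 \<noteq> 0" by (simp add: V_gf_0)
  then have iv: "V_gf k * inverse (V_gf k) = 1" by (rule inverse_mult_eq_1')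
  \<comment> \<open>The numerators are N and Delta'. Simplicity of the root serves twice, the second
    time as the nonvanishing of Delta'.\<close>
  have "(\<lambda>n. (fps_of_poly ?N * inverse (V_gf k)) $ n / (fps_of_poly (pderiv ?D) * inverse (V_gf k)) $ n)
      \<longlonglongrightarrow> poly ?N ?\<rho> / poly (pderiv ?D) ?\<rho>"
    using inv_sqrt_coeff_ratio_limit[OF \<rho>0 \<rho>(2) _ V0 root simple uniq simple] V_gf_square
    unfolding s_def by blast
  moreover have "fps_of_poly ?N * inverse (V_gf k) = 2 * L_gf k - of_nat k * T_gf k"
  proof -
    have "fps_of_poly ?N = (2 * L_gf k - of_nat k * T_gf k) * V_gf k"
      using L_gf_V_gf[of k] unfolding s_def by (simp add: algebra_simps)
    then show ?thesis by (simp add: mult.assoc iv)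
  qed
  moreover have "fps_of_poly (pderiv ?D) * inverse (V_gf k) = 2 * fps_deriv (V_gf k)"
  proof -
    have "fps_of_poly (pderiv ?D) = fps_deriv ((V_gf k)\<^sup>2)"
      by (simp only: fps_of_poly_pderiv V_gf_square s_def)
    also have "\<dots> = 2 * fps_deriv (V_gf k) * V_gf k"
      by (simp add: power2_eq_square algebra_simps)
    finally show ?thesis by (simp add: mult.assoc iv)
  qed
  ultimately have "(\<lambda>n. (2 * L_gf k - of_nat k * T_gf k) $ n / (2 * fps_deriv (V_gf k)) $ n)
      \<longlonglongrightarrow> poly ?N ?\<rho> / poly (pderiv ?D) ?\<rho>" by simp
  \<comment> \<open>For n > 2k the monomial kT drops out. The derivative shifts the index, hence
    \<open>Suc n\<close> in place of \<open>n\<close>.\<close>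
  moreover have "(2 * L_gf k - of_nat k * T_gf k) $ n / (2 * fps_deriv (V_gf k)) $ n =
      of_real (real (L_coeff k n) / (real (Suc n) * (- 4 * real (R_coeff k n))))" if "n > 2 * k" for n
  proof -
    have "(2 * L_gf k - of_nat k * T_gf k) $ n = 2 * of_nat (L_coeff k n)"
      using that by (simp add: T_gf_nth L_gf_def fps_numeral_mult_nth fps_mult_of_nat_nth)
    moreover have "(2 * fps_deriv (V_gf k)) $ n = 2 * (of_nat (Suc n) * (- 4 * of_nat (R_coeff k n)))"
      using V_gf_Suc[OF that] by (simp add: fps_numeral_mult_nth)
    ultimately have "(2 * L_gf k - of_nat k * T_gf k) $ n / (2 * fps_deriv (V_gf k)) $ n =
        (2 * of_nat (L_coeff k n)) / (2 * (of_nat (Suc n) * (- 4 * of_nat (R_coeff k n))))" by (simp only:)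
    also have "\<dots> = of_nat (L_coeff k n) / (of_nat (Suc n) * (- 4 * of_nat (R_coeff k n)))"
      by (rule nonzero_mult_divide_mult_cancel_left) simp
    also have "\<dots> = of_real (real (L_coeff k n) / (real (Suc n) * (- 4 * real (R_coeff k n))))"
      by (simp del: of_nat_Suc)
    finally show ?thesis .
  qed
  then have "eventually (\<lambda>n. (2 * L_gf k - of_nat k * T_gf k) $ n / (2 * fps_deriv (V_gf k)) $ n =
      of_real (real (L_coeff k n) / (real (Suc n) * (- 4 * real (R_coeff k n))))) sequentially"
    using eventually_gt_at_top by (rule eventually_mono[rotated])
  moreover have "poly ?N ?\<rho> / poly (pderiv ?D) ?\<rho> = of_real (ell_at k (s * \<rho> ^ (2 * k)) \<rho> / (-4))"
  proof -
    have "\<rho> ^ (4 * k) = (\<rho> ^ (2 * k))\<^sup>2" by (simp flip: power_mult)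
    then have "?\<rho> ^ (4 * k) = (?\<rho> ^ (2 * k))\<^sup>2" by (metis of_real_power)
    then have "poly ?N ?\<rho> = of_real (2 * k * \<rho> - k * (s * \<rho> ^ (2 * k)) + k * (s * \<rho> ^ (2 * k)) * \<rho> + 2 * k * (s * \<rho> ^ (2 * k))\<^sup>2 * \<rho>)"
      unfolding num_poly_def by (simp add: poly_monom power_add algebra_simps power2_eq_square)
    then have "poly ?N ?\<rho> / poly (pderiv ?D) ?\<rho> = of_real ((2 * k * \<rho> - k * (s * \<rho> ^ (2 * k))
        + k * (s * \<rho> ^ (2 * k)) * \<rho> + 2 * k * (s * \<rho> ^ (2 * k))\<^sup>2 * \<rho>) / real_disc_deriv \<rho>)"
      by (simp only: poly_pderiv_disc_of_real of_real_divide)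
    moreover have "- 4 * a / b / - 4 = a / b" for a b :: real by simp
    ultimately show ?thesis
      unfolding ell_at_def real_disc_deriv_def by (simp only: of_nat_mult of_nat_numeral mult.assoc)
  qed
  ultimately have "(\<lambda>n. complex_of_real (real (L_coeff k n) / (real (Suc n) * (- 4 * real (R_coeff k n)))))
      \<longlonglongrightarrow> of_real (ell_at k (s * \<rho> ^ (2 * k)) \<rho> / (-4))"
    using Lim_transform_eventually by fastforce
  then have "(\<lambda>n. real (L_coeff k n) / (real (Suc n) * (- 4 * real (R_coeff k n))))
      \<longlonglongrightarrow> ell_at k (s * \<rho> ^ (2 * k)) \<rho> / (-4)"
    by (simp only: tendsto_of_real_iff)
  \<comment> \<open>The factor -4(n + 1)/n tends to -4; it replaces \<open>Suc n\<close> by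
    \<open>n\<close> and removes the -4 of V'.\<close>
  then have "(\<lambda>n. (- 4 * (real (Suc n) / real n)) * (real (L_coeff k n) / (real (Suc n) * (- 4 * real (R_coeff k n)))))
      \<longlonglongrightarrow> (- 4 * 1) * (ell_at k (s * \<rho> ^ (2 * k)) \<rho> / (-4))"
    by (intro tendsto_mult tendsto_const LIMSEQ_Suc_n_over_n)
  moreover have "(- 4 * (real (Suc n) / real n)) * (real (L_coeff k n) / (real (Suc n) * (- 4 * real (R_coeff k n))))
      = real (L_coeff k n) / (real n * real (R_coeff k n))" for n
    by (simp add: field_simps del: of_nat_Suc)
  ultimately have "(\<lambda>n. real (L_coeff k n) / (real n * real (R_coeff k n)))
      \<longlonglongrightarrow> ell_at k (s * \<rho> ^ (2 * k)) \<rho>" by simp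
  then show ?thesis using \<rho> unfolding s_def by blast
qed

section \<open>The size of T on the disc\<close>

text \<open>The gain of (k + 1)^2 is what \<open>sigma_star_mass\<close> spends. Equality at k = 2
  fixes the constant 2.\<close>

lemma fact_le_power: "k \<ge> 2 \<Longrightarrow> fact k * (real k + 1)\<^sup>2 \<le> 2 * (real k + 1) ^ k"
proof (induction k rule: dec_induct)
  case base
  then show ?case by (simp add: numeral_2_eq_2)
next
  case (step k)
  \<comment> \<open>This form lets (k + 1)^2 be cancelled from the induction hypothesis.\<close>
  obtain m where m: "k = m + 2" using step(1) by (metis add.commute le_Suc_ex)
  have "fact k * (real k + 1)\<^sup>2 \<le> (2 * (real k + 1) ^ m) * (real k + 1)\<^sup>2"
    using step(3) by (simp only: m power_add mult.assoc)
  then have "fact k \<le> 2 * (real k + 1) ^ m" by (rule mult_right_le_imp_le) simp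
  then have "(real k + 1) * fact k \<le> (real k + 1) * (2 * (real k + 1) ^ m)"
    by (rule mult_left_mono) simp
  also have "\<dots> = 2 * (real k + 1) ^ Suc m" by simp
  also have "\<dots> \<le> 2 * (real (Suc k) + 1) ^ Suc m"
    by (intro mult_left_mono power_mono) auto
  finally have "fact (Suc k) \<le> 2 * (real (Suc k) + 1) ^ Suc m"
    by (simp only: fact_Suc of_nat_Suc add.commute)
  then have "fact (Suc k) * (real (Suc k) + 1)\<^sup>2 \<le> 2 * (real (Suc k) + 1) ^ Suc m * (real (Suc k) + 1)\<^sup>2"
    by (rule mult_right_mono) simp
  also have "\<dots> = 2 * (real (Suc k) + 1) ^ (Suc m + 2)" by (simp only: power_add mult.assoc)
  finally show ?case by (simp only: m add_Suc)
qed

definition rad :: "nat \<Rightarrow> real" where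
  "rad k = 1 / sqrt (8 * (real k + 1))"

text \<open>The count 4^k k!/2 divided by (8(k + 1))^k leaves 2^(-k). One factor k + 1 meets the
  demand of \<open>small\<close>; the other, at least 3, improves 1/4 to 1/12.\<close>

lemma sigma_star_mass:
  assumes "k \<ge> 2"
  shows "real (card (sigma_stars k)) * rad k ^ (2 * k) * (real k + 1)\<^sup>2 \<le> 1 / 2 ^ k"
proof -
  let ?s = "real (card (sigma_stars k))"
  have "rad k ^ (2 * k) = 1 / (8 * (real k + 1)) ^ k"
    by (simp add: rad_def power_mult power_divide)
  also have "(8 * (real k + 1)) ^ k = 4 ^ k * 2 ^ k * (real k + 1) ^ k"
    by (simp flip: power_mult_distrib)
  finally have r: "rad k ^ (2 * k) = 1 / (4 ^ k * 2 ^ k * (real k + 1) ^ k)" .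
  have "2 * ?s \<le> 4 ^ k * fact k"
    using of_nat_mono[OF card_sigma_stars[of k], where 'a = real] by simp
  then have "2 * ?s * (real k + 1)\<^sup>2 \<le> 4 ^ k * fact k * (real k + 1)\<^sup>2"
    by (rule mult_right_mono) simp
  also have "\<dots> \<le> 4 ^ k * (2 * (real k + 1) ^ k)"
    using fact_le_power[OF assms] by (simp add: mult.assoc mult_left_mono)
  finally have "?s * (real k + 1)\<^sup>2 \<le> 4 ^ k * (real k + 1) ^ k" by simp
  then have "?s * (real k + 1)\<^sup>2 * rad k ^ (2 * k) \<le> 4 ^ k * (real k + 1) ^ k * rad k ^ (2 * k)"
    by (rule mult_right_mono) (simp add: rad_def)
  also have "\<dots> = 1 / 2 ^ k" unfolding r by simp
  finally show ?thesis by (simp add: mult_ac)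
qed

lemma small_disc_sigma_stars:
  assumes "k \<ge> 2"
  shows "small_disc k (real (card (sigma_stars k))) (rad k)"
proof
  show "k \<ge> 2" by fact
  show "rad k > 0" "8 * (real k + 1) * (rad k)\<^sup>2 = 1" by (simp_all add: rad_def power_divide)
  let ?m = "real (card (sigma_stars k)) * rad k ^ (2 * k) * (real k + 1)"
  have "?m * 3 \<le> ?m * (real k + 1)"
    using assms by (intro mult_left_mono) (auto simp: rad_def)
  also have "\<dots> \<le> 1 / 2 ^ k" using sigma_star_mass[OF assms] by (simp add: power2_eq_square mult.assoc)
  also have "\<dots> \<le> 1 / 2 ^ 2" using assms by (intro divide_left_mono power_increasing) auto
  finally show "?m \<le> 1 / 12" by simp
qed simp

section \<open>The limit in k\<close>

text \<open>Dividing numerator and denominator by kx leaves terms in t, t/x, 1/k and 1/(kx). Since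
  1/x is of order at most sqrt k and t decays exponentially, they vanish and -8/(-16)
  remains.\<close>

lemma ell_at_limit:
  assumes "\<And>k. k \<ge> 2 \<Longrightarrow> rad k / (1 + rad k) \<le> x k"
    and "\<And>k. k \<ge> 2 \<Longrightarrow> 0 \<le> t k \<and> t k \<le> 1 / 2 ^ k"
  shows "(\<lambda>k. ell_at k (t k) (x k)) \<longlonglongrightarrow> 1 / 2"
proof -
  have x0: "0 < x k" and ix: "1 / x k \<le> sqrt (8 * (real k + 1)) + 1" if "k \<ge> 2" for k
  proof -
    have r: "rad k > 0" by (simp add: rad_def)
    then show "0 < x k" using assms(1)[OF that] by (meson add_pos_pos divide_pos_pos less_le_trans zero_less_one)
    have "1 / x k \<le> 1 / (rad k / (1 + rad k))"
      using assms(1)[OF that] r by (intro divide_left_mono mult_pos_pos \<open>0 < x k\<close>) auto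
    also have "\<dots> = sqrt (8 * (real k + 1)) + 1" using r by (simp add: rad_def field_simps)
    finally show "1 / x k \<le> sqrt (8 * (real k + 1)) + 1" .
  qed
  have ev: "eventually (\<lambda>k. k \<ge> 2) sequentially" by (rule eventually_ge_at_top)
  have t: "t \<longlonglongrightarrow> 0"
  proof (rule tendsto_sandwich[of "\<lambda>_. 0" _ _ "\<lambda>k. 1 / 2 ^ k"])
    show "(\<lambda>k. 1 / 2 ^ k :: real) \<longlonglongrightarrow> 0" by real_asymp
    show "eventually (\<lambda>k. 0 \<le> t k) sequentially" "eventually (\<lambda>k. t k \<le> 1 / 2 ^ k) sequentially"
      using ev by (eventually_elim, use assms(2) in blast)+
  qed simp
  have tx: "(\<lambda>k. t k / x k) \<longlonglongrightarrow> 0"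
  proof (rule tendsto_sandwich[of "\<lambda>_. 0" _ _ "\<lambda>k. 1 / 2 ^ k * (sqrt (8 * (real k + 1)) + 1)"])
    show "(\<lambda>k. 1 / 2 ^ k * (sqrt (8 * (real k + 1)) + 1)) \<longlonglongrightarrow> 0" by real_asymp
    show "eventually (\<lambda>k. 0 \<le> t k / x k) sequentially"
      using ev by eventually_elim (use assms(2) x0 in \<open>auto intro: divide_nonneg_nonneg less_imp_le\<close>)
    show "eventually (\<lambda>k. t k / x k \<le> 1 / 2 ^ k * (sqrt (8 * (real k + 1)) + 1)) sequentially"
      using ev
    proof eventually_elim
      case (elim k)
      have "t k * (1 / x k) \<le> 1 / 2 ^ k * (sqrt (8 * (real k + 1)) + 1)"
        using assms(2)[OF elim] ix[OF elim] x0[OF elim] by (intro mult_mono) auto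
      then show ?case by simp
    qed
  qed simp
  have kx: "(\<lambda>k. 1 / x k / real k) \<longlonglongrightarrow> 0"
  proof (rule tendsto_sandwich[of "\<lambda>_. 0" _ _ "\<lambda>k. (sqrt (8 * (real k + 1)) + 1) / real k"])
    show "(\<lambda>k. (sqrt (8 * (real k + 1)) + 1) / real k) \<longlonglongrightarrow> 0" by real_asymp
    show "eventually (\<lambda>k. 0 \<le> 1 / x k / real k) sequentially"
      using ev by eventually_elim (use x0 in \<open>auto intro: divide_nonneg_nonneg less_imp_le\<close>)
    show "eventually (\<lambda>k. 1 / x k / real k \<le> (sqrt (8 * (real k + 1)) + 1) / real k) sequentially"
      using ev by eventually_elim (rule divide_right_mono[OF ix], simp_all)
  qed simp
  have ik: "(\<lambda>k. 1 / real k) \<longlonglongrightarrow> 0" by real_asymp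
  define num where "num k = - 4 * (2 - t k / x k + t k + 2 * (t k)\<^sup>2)" for k
  define den where "den k = - 2 * (1 / x k / real k) - 2 * (8 + 7 * (1 / real k)) + 4 * (t k / x k) * (2 + 1 / real k)
       - 4 * t k * (2 + 2 * (1 / real k)) - 4 * (t k)\<^sup>2 * (4 + 2 * (1 / real k))" for k
  have "(\<lambda>k. num k / den k) \<longlonglongrightarrow> (- 4 * (2 - 0 + 0 + 2 * 0\<^sup>2)) /
      (- 2 * 0 - 2 * (8 + 7 * 0) + 4 * 0 * (2 + 0) - 4 * 0 * (2 + 2 * 0) - 4 * 0\<^sup>2 * (4 + 2 * 0))"
    unfolding num_def den_def by (intro tendsto_intros t tx kx ik) auto
  then have "(\<lambda>k. num k / den k) \<longlonglongrightarrow> 1 / 2" by simp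
  moreover have "eventually (\<lambda>k. num k / den k = ell_at k (t k) (x k)) sequentially"
    using ev
  proof eventually_elim
    case (elim k)
    have nz: "real k * x k \<noteq> 0" using elim x0[OF elim] by auto
    have "num k / den k = (num k * (real k * x k)) / (den k * (real k * x k))"
      using nz by simp
    also have "num k * (real k * x k) = - 4 * (2 * k * x k - k * t k + k * t k * x k + 2 * k * (t k)\<^sup>2 * x k)"
      using nz by (simp add: num_def field_simps)
    also have "den k * (real k * x k) = - 2 - 2 * (8 * real k + 7) * x k + 4 * t k * (2 * real k + 1)
       - 4 * t k * (2 * real k + 2) * x k - 4 * (t k)\<^sup>2 * (4 * real k + 2) * x k"
      using nz by (simp add: den_def field_simps)
    finally show ?case by (simp add: ell_at_def)
  qed
  ultimately show ?thesis by (rule Lim_transform_eventually)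
qed

theorem theorem6:
  shows "\<exists>ell :: nat \<Rightarrow> real.
           (\<forall>k\<ge>2. (\<lambda>n. real (L_coeff k n) / (real n * real (R_coeff k n))) \<longlonglongrightarrow> ell k)
         \<and> ell \<longlonglongrightarrow> 1/2"
proof -
  let ?s = "\<lambda>k. real (card (sigma_stars k))"
  define root_limit where "root_limit k x \<longleftrightarrow> rad k / (1 + rad k) \<le> x \<and> x < rad k \<and>
      (\<lambda>n. real (L_coeff k n) / (real n * real (R_coeff k n))) \<longlonglongrightarrow> ell_at k (?s k * x ^ (2 * k)) x"
    for k x
  have "\<exists>x. root_limit k x" if "k \<ge> 2" for k
    unfolding root_limit_def by (rule ratio_limit[OF small_disc_sigma_stars[OF that]])
  \<comment> \<open>The guard moves under the existential quantifier so that \<open>choice\<close>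
    yields one function of k.\<close>
  then have "\<forall>k. \<exists>x. k \<ge> 2 \<longrightarrow> root_limit k x" by blast
  then obtain \<rho> where *: "\<forall>k. k \<ge> 2 \<longrightarrow> root_limit k (\<rho> k)" by (rule choice[THEN exE])
  have \<rho>: "rad k / (1 + rad k) \<le> \<rho> k" "\<rho> k < rad k"
    and lim: "(\<lambda>n. real (L_coeff k n) / (real n * real (R_coeff k n)))
        \<longlonglongrightarrow> ell_at k (?s k * \<rho> k ^ (2 * k)) (\<rho> k)" if "k \<ge> 2" for k
    using *[rule_format, OF that] unfolding root_limit_def by blast+
  have "(\<lambda>k. ell_at k (?s k * \<rho> k ^ (2 * k)) (\<rho> k)) \<longlonglongrightarrow> 1 / 2"
  proof (rule ell_at_limit[OF \<rho>(1)])
    fix k :: nat assume k: "k \<ge> 2"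
    have "0 \<le> rad k / (1 + rad k)" by (simp add: rad_def)
    then have \<rho>0: "0 \<le> \<rho> k" using \<rho>(1)[OF k] by linarith
    have "?s k * \<rho> k ^ (2 * k) \<le> ?s k * rad k ^ (2 * k)"
      using \<rho>0 \<rho>(2)[OF k] by (intro mult_left_mono power_mono) auto
    \<comment> \<open>A factor of at least 1 is inserted to reach the form of
      \<open>sigma_star_mass\<close>.\<close>
    also have "\<dots> \<le> ?s k * rad k ^ (2 * k) * (real k + 1)\<^sup>2"
    proof -
      have "1 \<le> (real k + 1)\<^sup>2" by simp
      moreover have "0 \<le> ?s k * rad k ^ (2 * k)" by (simp add: rad_def)
      ultimately have "?s k * rad k ^ (2 * k) * 1 \<le> ?s k * rad k ^ (2 * k) * (real k + 1)\<^sup>2"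
        by (rule mult_left_mono)
      then show ?thesis by simp
    qed
    also have "\<dots> \<le> 1 / 2 ^ k" by (rule sigma_star_mass[OF k])
    finally have le: "?s k * \<rho> k ^ (2 * k) \<le> 1 / 2 ^ k" .
    have "0 \<le> ?s k * \<rho> k ^ (2 * k)" using \<rho>0 by simp
    then show "0 \<le> ?s k * \<rho> k ^ (2 * k) \<and> ?s k * \<rho> k ^ (2 * k) \<le> 1 / 2 ^ k"
      using le by (rule conjI)
  qed
  with lim show ?thesis
    by (intro exI[of _ "\<lambda>k. ell_at k (?s k * \<rho> k ^ (2 * k)) (\<rho> k)"] conjI allI impI)
qed

end
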